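(* Under the assumptions listed in the context on $(\theta_j)$, $(a_j)$, $(b_j)$, $V$ and $t(x,y)$, the transition rates of the spatial coagulation-fragmentation dynamics described in the context define uniquely a Markov semi-group with state space $\Lambda_n$. The measure $\mathbb P_{L,n}$ is reversible, hence stationary, for the associated Markov process.
   Context: Let $d\ge1$, $n\in\mathbb N$, $L>0$, $V:\mathbb R^d\to(-\infty,\infty]$, and $(\theta_j)_{j\ge1}$ non-negative. A spatial partition of $n$ is a family $\boldsymbol\lambda=(\lambda_x)_{x\in\mathbb Z^d}$ of integer partitions (possibly empty) whose parts sum in total to $n$; $\Lambda_n$ is the set of these. $r_{xj}=r_{xj}(\boldsymbol\lambda)$ is the number of parts of $\lambda_x$ equal to $j$ (the number of $j$-clusters at $x$). Define $$\mathbb P_{L,n}(\boldsymbol\lambda)=\frac1{Z_{L,n}}\prod_{x\in\mathbb Z^d}\prod_{j\ge1}\frac1{r_{xj}!}\Bigl(\frac{\theta_j}{j}e^{-jV(x/L)}\Bigr)^{r_{xj}},$$ with normalization $Z_{L,n}$ assumed finite (and non-zero), $e^{-\infty}=0$, $0^0=1$. Assumptions. $(a_j)_{j\ge1}$ and $(b_j)_{j\ge2}$ are positive sequences with $a_j\frac{\theta_j}{j}\theta_1=b_{j+1}\frac{\theta_{j+1}}{j+1}$ for all $j\ge1$. The numbers $t(x,y)\ge0$, $x,y\in\mathbb Z^d$, satisfy $\sum_yt(x,y)=1$ and $e^{-V(x/L)}t(x,y)=e^{-V(y/L)}t(y,x)$. Moreover, for some $z>0$ such that $\sum_{x\in\mathbb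 Z^d}\sum_{j\ge1}\frac{\theta_j}{j}z^je^{-jV(x/L')}<\infty$ for all $L'>0$, one has $$\sum_{x,y\in\mathbb Z^d}e^{-V(x/L)}t(x,y)<\infty,\qquad\sum_{x\in\mathbb Z^d,\,j\ge2}b_j\frac{\theta_j}{j}z^je^{-jV(x/L)}<\infty.$$ Dynamics: three types of transitions. (1) Coagulation at a site $x$: a $j$-cluster ($j\ge1$) and a $1$-cluster at $x$ merge into a $(j+1)$-cluster. For $j\ne1$: $(r_{x1},r_{xj},r_{x,j+1})\to(r_{x1}-1,r_{xj}-1,r_{x,j+1}+1)$ at rate $a_jr_{xj}r_{x1}$; for $j=1$: $(r_{x1},r_{x2})\to(r_{x1}-2,r_{x2}+1)$ at rate $a_1r_{x1}(r_{x1}-1)$. (2) Fragmentation at a site $x$: a $j$-cluster ($j\ge2$) splits into a $(j-1)$-cluster and a $1$-cluster, at rate $b_jr_{xj}$; i.e. $r_{xj}$ decreases by one and $r_{x,j-1}$ and $r_{x1}$ each increase by one (so $r_{x1}$ increases by two if $j=2$). (3) Jump of a $1$-cluster from $x$ to $y\ne x$: $(r_{x1},r_{y1})\to(r_{x1}-1,r_{y1}+1)$ at rate $r_{x1}t(x,y)$. *)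

theory Defs
  imports "HOL-Probability.Probability" "HOL-Library.Multiset"
begin

text \<open>An integer partition is the multiset of its (positive) parts, so the number \<open>r\<^sub>x\<^sub>j\<close> of
  \<open>j\<close>-clusters at \<open>x\<close> is \<^term>\<open>count (lam x) j\<close>.\<close>

type_synonym 'd config = "(int ^ 'd) \<Rightarrow> nat multiset"

definition spatial_partitions :: "nat \<Rightarrow> ('d::finite) config set" where
  "spatial_partitions n =
     {lam. (\<forall>x. 0 \<notin># lam x) \<and> finite {x. lam x \<noteq> {#}} \<and>
           (\<Sum>x | lam x \<noteq> {#}. sum_mset (lam x)) = n}"

text \<open>\<open>exp (-v)\<close> for \<open>v\<close> in \<open>(-\<infinity>, \<infinity>]\<close>, with \<open>exp (-\<infinity>) = 0\<close>.\<close>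

definition exp_minus :: "ereal \<Rightarrow> real" where
  "exp_minus v = (if v = \<infinity> then 0 else exp (- real_of_ereal v))"

definition scaled :: "real \<Rightarrow> int ^ 'd \<Rightarrow> real ^ ('d::finite)" where
  "scaled L x = (\<chi> i. real_of_int (x $ i) / L)"

definition boltzmann :: "(real ^ 'd \<Rightarrow> ereal) \<Rightarrow> real \<Rightarrow> nat \<Rightarrow> int ^ ('d::finite) \<Rightarrow> real" where
  "boltzmann V L j x = exp_minus (ereal (real j) * V (scaled L x))"

text \<open>All factors with \<open>r\<^sub>x\<^sub>j = 0\<close> equal 1 (recall \<open>0 ^ 0 = 1\<close>), so the products over all sites
  and all \<open>j \<ge> 1\<close> reduce to the finite products below.\<close>

definition gibbs_weight ::
  "(real ^ 'd \<Rightarrow> ereal) \<Rightarrow> real \<Rightarrow> (nat \<Rightarrow> real) \<Rightarrow> ('d::finite) config \<Rightarrow> real" where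
  "gibbs_weight V L \<theta> lam =
     (\<Prod>x | lam x \<noteq> {#}. \<Prod>j\<in>set_mset (lam x).
        1 / fact (count (lam x) j) * (\<theta> j / real j * boltzmann V L j x) ^ count (lam x) j)"

definition partition_function ::
  "(real ^ ('d::finite) \<Rightarrow> ereal) \<Rightarrow> real \<Rightarrow> (nat \<Rightarrow> real) \<Rightarrow> nat \<Rightarrow> real" where
  "partition_function V L \<theta> n = (\<Sum>\<^sub>\<infinity>lam\<in>spatial_partitions n. gibbs_weight V L \<theta> lam)"

definition gibbs_prob ::
  "(real ^ 'd \<Rightarrow> ereal) \<Rightarrow> real \<Rightarrow> (nat \<Rightarrow> real) \<Rightarrow> nat \<Rightarrow> ('d::finite) config \<Rightarrow> real" where
  "gibbs_prob V L \<theta> n lam = gibbs_weight V L \<theta> lam / partition_function V L \<theta> n"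

datatype 'x event = Coag 'x nat | Frag 'x nat | Jump 'x 'x

fun admissible :: "'x event \<Rightarrow> bool" where
  "admissible (Coag x j) = (1 \<le> j)"
| "admissible (Frag x j) = (2 \<le> j)"
| "admissible (Jump x y) = (x \<noteq> y)"

text \<open>Multiset difference truncates, but whenever a cluster to be removed is missing, the
  corresponding rate below vanishes.\<close>

fun target :: "(int ^ ('d::finite)) event \<Rightarrow> 'd config \<Rightarrow> 'd config" where
  "target (Coag x j) lam = lam(x := lam x - {#1, j#} + {#j + 1#})"
| "target (Frag x j) lam = lam(x := lam x - {#j#} + {#j - 1, 1#})"
| "target (Jump x y) lam = lam(x := lam x - {#1#}, y := lam y + {#1#})"

fun event_rate ::
  "(nat \<Rightarrow> real) \<Rightarrow> (nat \<Rightarrow> real) \<Rightarrow> (int ^ 'd \<Rightarrow> int ^ 'd \<Rightarrow> real) \<Rightarrow>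
   (int ^ ('d::finite)) event \<Rightarrow> 'd config \<Rightarrow> real" where
  "event_rate a b t (Coag x j) lam =
     (if j = 1 then a 1 * real (count (lam x) 1) * (real (count (lam x) 1) - 1)
      else a j * real (count (lam x) j) * real (count (lam x) 1))"
| "event_rate a b t (Frag x j) lam = b j * real (count (lam x) j)"
| "event_rate a b t (Jump x y) lam = real (count (lam x) 1) * t x y"

text \<open>On spatial partitions, at most one event leads from \<open>lam\<close> to \<open>mu\<close> with non-zero rate.\<close>

definition transition_rate ::
  "(nat \<Rightarrow> real) \<Rightarrow> (nat \<Rightarrow> real) \<Rightarrow> (int ^ 'd \<Rightarrow> int ^ 'd \<Rightarrow> real) \<Rightarrow>
   ('d::finite) config \<Rightarrow> 'd config \<Rightarrow> real" where
  "transition_rate a b t lam mu =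
     (\<Sum>\<^sub>\<infinity>e\<in>{e. admissible e \<and> target e lam = mu}. event_rate a b t e lam)"

text \<open>\<^term>\<open>P s x\<close> is the law at time \<open>s \<ge> 0\<close> of the chain started in \<open>x\<close>; the values of \<open>P\<close> for
  \<open>s < 0\<close> or \<open>x \<notin> S\<close> are irrelevant. The last clause is standardness (continuity at 0).\<close>

definition markov_semigroup :: "'s set \<Rightarrow> (real \<Rightarrow> 's \<Rightarrow> 's pmf) \<Rightarrow> bool" where
  "markov_semigroup S P \<longleftrightarrow>
     (\<forall>s\<ge>0. \<forall>x\<in>S. set_pmf (P s x) \<subseteq> S) \<and>
     (\<forall>x\<in>S. P 0 x = return_pmf x) \<and>
     (\<forall>s\<ge>0. \<forall>u\<ge>0. \<forall>x\<in>S. P (s + u) x = bind_pmf (P s x) (P u)) \<and>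
     (\<forall>x\<in>S. ((\<lambda>h. pmf (P h x) x) \<longlongrightarrow> 1) (at_right 0))"

definition q_matrix :: "'s set \<Rightarrow> ('s \<Rightarrow> 's \<Rightarrow> real) \<Rightarrow> 's \<Rightarrow> 's \<Rightarrow> real" where
  "q_matrix S q x y = (if x = y then - (\<Sum>\<^sub>\<infinity>w\<in>S - {x}. q x w) else q x y)"

definition has_rates :: "'s set \<Rightarrow> ('s \<Rightarrow> 's \<Rightarrow> real) \<Rightarrow> (real \<Rightarrow> 's \<Rightarrow> 's pmf) \<Rightarrow> bool" where
  "has_rates S q P \<longleftrightarrow>
     (\<forall>x\<in>S. q x summable_on (S - {x})) \<and>
     (\<forall>x\<in>S. \<forall>y\<in>S. ((\<lambda>h. pmf (P h x) y) has_real_derivative q_matrix S q x y) (at_right 0))"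

definition reversible_measure :: "'s set \<Rightarrow> (real \<Rightarrow> 's \<Rightarrow> 's pmf) \<Rightarrow> ('s \<Rightarrow> real) \<Rightarrow> bool" where
  "reversible_measure S P p \<longleftrightarrow>
     (\<forall>s\<ge>0. \<forall>x\<in>S. \<forall>y\<in>S. p x * pmf (P s x) y = p y * pmf (P s y) x)"

definition stationary_measure :: "'s set \<Rightarrow> (real \<Rightarrow> 's \<Rightarrow> 's pmf) \<Rightarrow> ('s \<Rightarrow> real) \<Rightarrow> bool" where
  "stationary_measure S P p \<longleftrightarrow>
     (\<forall>s\<ge>0. \<forall>y\<in>S. ((\<lambda>x. p x * pmf (P s x) y) has_sum p y) S)"

text \<open>\<^term>\<open>path_prob M X J c\<close> is the probability that \<open>X u = c u\<close> at all times \<open>u \<in> J\<close>.\<close>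

definition path_prob :: "'w measure \<Rightarrow> (real \<Rightarrow> 'w \<Rightarrow> 's) \<Rightarrow> real set \<Rightarrow> (real \<Rightarrow> 's) \<Rightarrow> real" where
  "path_prob M X J c = measure M {\<omega> \<in> space M. \<forall>u\<in>J. X u \<omega> = c u}"

text \<open>The last clause is the Markov property with transition function \<open>P\<close>, multiplied out so that
  no conditioning on null events occurs: \<open>u\<close> is the present, \<open>J\<close> a finite set of times up to
  \<open>u\<close>, and \<open>v\<close> a future time.\<close>

definition markov_process ::
  "'s set \<Rightarrow> (real \<Rightarrow> 's \<Rightarrow> 's pmf) \<Rightarrow> ('s \<Rightarrow> real) \<Rightarrow> 'w measure \<Rightarrow> (real \<Rightarrow> 'w \<Rightarrow> 's) \<Rightarrow> bool" where
  "markov_process S P p M X \<longleftrightarrow>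
     prob_space M \<and>
     (\<forall>u\<ge>0. X u \<in> measurable M (count_space S)) \<and>
     (\<forall>x\<in>S. measure M {\<omega> \<in> space M. X 0 \<omega> = x} = p x) \<and>
     (\<forall>J u v c. finite J \<and> J \<subseteq> {0..u} \<and> u \<in> J \<and> u < v \<and> (\<forall>w\<in>insert v J. c w \<in> S) \<longrightarrow>
        path_prob M X (insert v J) c = path_prob M X J c * pmf (P (v - u) (c u)) (c v))"

text \<open>Reversibility and stationarity of a process: equality of the finite-dimensional
  distributions of \<open>X\<close> with those of its time reversals, respectively time shifts.\<close>

definition reversible_process :: "'s set \<Rightarrow> 'w measure \<Rightarrow> (real \<Rightarrow> 'w \<Rightarrow> 's) \<Rightarrow> bool" where
  "reversible_process S M X \<longleftrightarrow>
     (\<forall>T J c. finite J \<and> J \<subseteq> {0..T} \<and> (\<forall>u\<in>J. c u \<in> S) \<longrightarrow>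
        path_prob M (\<lambda>u. X (T - u)) J c = path_prob M X J c)"

definition stationary_process :: "'s set \<Rightarrow> 'w measure \<Rightarrow> (real \<Rightarrow> 'w \<Rightarrow> 's) \<Rightarrow> bool" where
  "stationary_process S M X \<longleftrightarrow>
     (\<forall>h\<ge>0. \<forall>J c. finite J \<and> J \<subseteq> {0..} \<and> (\<forall>u\<in>J. c u \<in> S) \<longrightarrow>
        path_prob M (\<lambda>u. X (u + h)) J c = path_prob M X J c)"

end

theory Submission imports Defs begin

text \<open>The total mass \<open>n\<close> is fixed, so a configuration has at most \<open>n\<close> clusters, each of size at most \<open>n\<close>, and the jump
  rates of a cluster sum to at most 1. Hence the total rate at which a configuration is left is bounded by a constant
  \<open>\<Lambda>\<close> that depends only on \<open>n\<close>, \<open>a\<close> and \<open>b\<close> (\<open>sum_event_rate_le\<close>), although there are infinitely many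
  configurations. The proposition is therefore a statement about a chain with bounded rates.

  Existence is by uniformization: run the discrete chain with transition matrix \<open>I + Q / \<Lambda>\<close> for a Poisson(\<open>\<Lambda> s\<close>)
  number of steps. The addition law of the Poisson distribution gives the semigroup property, and expanding in powers
  of \<open>s\<close> gives the derivative \<open>Q\<close> at 0.

  For uniqueness, compare this semigroup \<open>P\<close> with another one, \<open>P'\<close>, by cutting \<open>[0, s]\<close> into short intervals of length
  \<open>h\<close> and exchanging the steps one at a time (\<open>telescoping\<close>). One exchange costs \<open>o(h)\<close>, but not uniformly in the
  current position. This is repaired by \<open>P\<^sub>u x \<le> exp (\<Lambda> s) P\<^sub>s x\<close> for \<open>u \<le> s\<close>: the positions at all the
  exchanges can be averaged under the single law \<open>P\<^sub>s x\<close>, and dominated convergence applies. The dominating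
  function rests on \<open>escape_prob_le\<close>, which bounds the probability of leaving a state under any semigroup with these
  rates. Only \<open>P \<le> P'\<close> is shown; equality follows because both have total mass 1.

  Reversibility is detailed balance (\<open>transition_rate_balance\<close>). Each event has a reverse event, and the flow through
  both is the same because adding a \<open>j\<close>-cluster at \<open>x\<close> multiplies the Gibbs weight by \<open>\<theta>\<^sub>j / j exp (- j V)\<close> over the
  new count (\<open>gibbs_weight_add_cluster\<close>). Detailed balance passes to powers of the transition matrix and to their
  Poisson mixture, and gives stationarity on summing over the states. For a process with this transition
  function, the finite-dimensional distributions can then be built up both forwards and backwards in time
  (\<open>path_prob_prepend\<close>).\<close>

section \<open>Probability mass functions\<close>

lemma integrable_measure_pmf_bounded:
  fixes f :: "'a \<Rightarrow> real"
  assumes "\<And>x. \<bar>f x\<bar> \<le> B"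
  shows "integrable (measure_pmf p) f"
  by (rule measure_pmf.integrable_const_bound[where B = B]) (use assms in auto)

lemma expectation_pmf_count_space:
  fixes f :: "'a \<Rightarrow> real"
  shows "measure_pmf.expectation p f = (\<integral>x. pmf p x * f x \<partial>count_space UNIV)"
  by (simp add: measure_pmf_eq_density integral_density)

lemma integrable_pmf_mult_bounded:
  fixes f :: "'a \<Rightarrow> real"
  assumes "\<And>x. \<bar>f x\<bar> \<le> B"
  shows "integrable (count_space UNIV) (\<lambda>x. pmf p x * f x)"
  using integrable_measure_pmf_bounded[OF assms, of p]
  by (simp add: measure_pmf_eq_density integrable_density)

lemma expectation_nat_pmf_sums:
  fixes f :: "nat \<Rightarrow> real"
  assumes "\<And>k. \<bar>f k\<bar> \<le> B"
  shows "(\<lambda>k. pmf N k * f k) sums measure_pmf.expectation N f"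
  unfolding expectation_pmf_count_space
  by (rule sums_integral_count_space_nat) (rule integrable_pmf_mult_bounded[OF assms])

text \<open>Boundedness of \<^term>\<open>f\<close> makes every expectation finite, so that the law of total
  expectation can be read off from its version for non-negative extended reals.\<close>

lemma expectation_bind_pmf:
  fixes f :: "'b \<Rightarrow> real"
  assumes f: "\<And>y. 0 \<le> f y" "\<And>y. f y \<le> B"
  shows "measure_pmf.expectation (bind_pmf p k) f =
         measure_pmf.expectation p (\<lambda>x. measure_pmf.expectation (k x) f)"
proof -
  have int: "integrable (measure_pmf r) f" for r :: "'b pmf"
    by (rule integrable_measure_pmf_bounded[where B = B]) (use f in \<open>auto simp: abs_le_iff intro: order_trans[of _ 0]\<close>)
  have nonneg: "0 \<le> measure_pmf.expectation r f" for r :: "'b pmf"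
    by (simp add: f)
  have "measure_pmf.expectation r f \<le> B" for r :: "'b pmf"
    by (rule measure_pmf.integral_le_const[OF int]) (simp add: f)
  then have int2: "integrable (measure_pmf p) (\<lambda>x. measure_pmf.expectation (k x) f)"
    by (intro integrable_measure_pmf_bounded[where B = B]) (use nonneg in \<open>auto simp: abs_le_iff intro: order_trans[of _ 0]\<close>)
  have "ennreal (measure_pmf.expectation (bind_pmf p k) f) = (\<integral>\<^sup>+y. f y \<partial>bind_pmf p k)"
    by (rule nn_integral_eq_integral[symmetric, OF int]) (simp add: f)
  also have "\<dots> = (\<integral>\<^sup>+x. ennreal (measure_pmf.expectation (k x) f) \<partial>p)"
    by (simp add: nn_integral_eq_integral[OF int] f)
  also have "\<dots> = ennreal (measure_pmf.expectation p (\<lambda>x. measure_pmf.expectation (k x) f))"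
    by (rule nn_integral_eq_integral[OF int2]) (simp add: nonneg)
  finally show ?thesis
    by (subst (asm) ennreal_inj) (simp_all add: f)
qed

lemma pmf_mult_le_pmf_bind: "pmf p x * pmf (k x) y \<le> pmf (bind_pmf p k) y"
proof -
  have "pmf p x * pmf (k x) y = measure_pmf.expectation p (\<lambda>w. indicator {x} w * pmf (k x) y)"
    by (simp add: measure_pmf_single)
  also have "\<dots> \<le> measure_pmf.expectation p (\<lambda>w. pmf (k w) y)"
    by (intro integral_mono integrable_measure_pmf_bounded[where B = 1])
       (auto simp: pmf_le_1 split: split_indicator)
  finally show ?thesis by (simp add: pmf_bind)
qed

text \<open>Both sides have total mass 1, so there is no room for a strict inequality. This turns a one-sided
  comparison of two semigroups into uniqueness.\<close>

lemma pmf_eq_of_le: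
  assumes le: "\<And>x. pmf p x \<le> pmf q x"
  shows "p = q"
proof (rule pmf_eqI)
  fix x
  have split: "pmf r x + measure (measure_pmf r) (- {x}) = 1" for r :: "'a pmf"
    using measure_pmf.prob_compl[of "{x}" r] by (simp add: measure_pmf_single Compl_eq_Diff_UNIV)
  have "measure (measure_pmf p) (- {x}) \<le> measure (measure_pmf q) (- {x})"
    unfolding integral_pmf[symmetric] by (intro integral_mono integrable_pmf le)
  then show "pmf p x = pmf q x"
    using split[of p] split[of q] le[of x] by linarith
qed

lemma abs_summable_on_iff_summable_on_real:
  fixes f :: "'a \<Rightarrow> real"
  shows "Infinite_Set_Sum.abs_summable_on f A \<longleftrightarrow> f summable_on A"
  using abs_summable_equivalent[of f A] summable_on_iff_abs_summable_on_real[of f A] by blast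

text \<open>Unordered sums, used for the rates, and integrals over the counting measure, used for
  probability mass functions, agree on non-negative families; this is the bridge between the two.\<close>

lemma nn_integral_count_space_has_sum:
  fixes f :: "'a \<Rightarrow> real"
  assumes "(f has_sum s) A" and "\<And>x. x \<in> A \<Longrightarrow> 0 \<le> f x"
  shows "(\<integral>\<^sup>+x. ennreal (f x) \<partial>count_space A) = ennreal s"
proof -
  have *: "Infinite_Set_Sum.abs_summable_on f A"
    using assms(1) by (simp add: abs_summable_on_iff_summable_on_real has_sum_imp_summable)
  show ?thesis
    using nn_integral_conv_infsetsum[OF * assms(2)] assms(1) by (simp add: infsetsum_infsum[OF *] infsumI)
qed

lemma pmf_embed_pmf_has_sum:
  fixes f :: "'a \<Rightarrow> real"
  assumes "\<And>x. 0 \<le> f x" and "(f has_sum 1) UNIV"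
  shows "pmf (embed_pmf f) x = f x"
  by (rule pmf_embed_pmf) (use assms nn_integral_count_space_has_sum[OF assms(2)] in auto)

lemma has_sum_expectation_pmf:
  fixes f :: "'a \<Rightarrow> real"
  assumes "\<And>x. \<bar>f x\<bar> \<le> B"
  shows "((\<lambda>x. pmf p x * f x) has_sum measure_pmf.expectation p f) UNIV"
proof -
  have *: "Infinite_Set_Sum.abs_summable_on (\<lambda>x. pmf p x * f x) UNIV"
    using integrable_pmf_mult_bounded[OF assms, of p]
    by (simp add: Infinite_Set_Sum.abs_summable_on_def)
  then have "(\<lambda>x. pmf p x * f x) summable_on UNIV"
    by (simp add: abs_summable_on_iff_summable_on_real)
  moreover have "infsum (\<lambda>x. pmf p x * f x) UNIV = measure_pmf.expectation p f"
    unfolding expectation_pmf_count_space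
    by (simp add: infsetsum_infsum[OF *, symmetric] infsetsum_def)
  ultimately show ?thesis
    by (metis has_sum_infsum)
qed

text \<open>The binomial theorem; it is what makes the uniformized chain satisfy the
  Chapman-Kolmogorov equations.\<close>

lemma poisson_pmf_add:
  assumes r: "0 < r" and s: "0 < s"
  shows "bind_pmf (poisson_pmf r) (\<lambda>i. map_pmf ((+) i) (poisson_pmf s)) = poisson_pmf (r + s)"
proof (rule pmf_eqI)
  fix k
  have shifted: "pmf (map_pmf ((+) i) (poisson_pmf s)) k =
      (if i \<le> k then s ^ (k - i) / fact (k - i) * exp (- s) else 0)" for i
  proof (cases "i \<le> k")
    case True
    then show ?thesis
      using pmf_map_inj'[of "(+) i" "poisson_pmf s" "k - i"] s by simp
  next
    case False
    then have "k \<notin> set_pmf (map_pmf ((+) i) (poisson_pmf s))" by auto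
    then show ?thesis using False by (simp add: set_pmf_iff del: set_map_pmf)
  qed
  have "pmf (bind_pmf (poisson_pmf r) (\<lambda>i. map_pmf ((+) i) (poisson_pmf s))) k =
      (\<Sum>i\<le>k. (s ^ (k - i) / fact (k - i) * exp (- s)) * (r ^ i / fact i * exp (- r)))"
    unfolding pmf_bind shifted using r
    by (subst integral_measure_pmf_real[where A = "{..k}"]) (auto split: if_splits intro!: sum.cong)
  also have "\<dots> = exp (- (r + s)) / fact k * (\<Sum>i\<le>k. real (k choose i) * r ^ i * s ^ (k - i))"
    unfolding sum_distrib_left
    by (intro sum.cong) (auto simp: binomial_fact field_simps exp_add Transcendental.exp_minus exp_diff)
  also have "\<dots> = pmf (poisson_pmf (r + s)) k"
    using r s by (simp add: binomial_ring)
  finally show "pmf (bind_pmf (poisson_pmf r) (\<lambda>i. map_pmf ((+) i) (poisson_pmf s))) k =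
      pmf (poisson_pmf (r + s)) k" .
qed

section \<open>Uniformization of bounded transition rates\<close>

text \<open>The generator of such a chain is a bounded operator. The constant \<open>\<Lambda>\<close> is the intensity of the Poisson
  clock by which the chain is driven; it may be any positive upper bound for the exit rates.\<close>

locale bounded_rates =
  fixes S :: "'s set" and q :: "'s \<Rightarrow> 's \<Rightarrow> real" and \<Lambda> :: real
  assumes rate_nonneg: "\<And>x y. x \<in> S \<Longrightarrow> y \<in> S \<Longrightarrow> x \<noteq> y \<Longrightarrow> 0 \<le> q x y"
    and rate_summable: "\<And>x. x \<in> S \<Longrightarrow> q x summable_on (S - {x})"
    and exit_rate_le: "\<And>x. x \<in> S \<Longrightarrow> infsum (q x) (S - {x}) \<le> \<Lambda>"
    and \<Lambda>_pos: "0 < \<Lambda>"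
begin

text \<open>One step of the embedded discrete chain has transition matrix \<open>I + Q / \<Lambda>\<close>. The bound on the exit rates is
  exactly what makes its diagonal non-negative.\<close>

definition step_prob :: "'s \<Rightarrow> 's \<Rightarrow> real" where
  "step_prob x y = (if y \<in> S then of_bool (x = y) + q_matrix S q x y / \<Lambda> else 0)"

definition step :: "'s \<Rightarrow> 's pmf" where
  "step x = (if x \<in> S then embed_pmf (step_prob x) else return_pmf x)"

primrec steps :: "nat \<Rightarrow> 's \<Rightarrow> 's pmf" where
  "steps 0 x = return_pmf x"
| "steps (Suc k) x = bind_pmf (step x) (steps k)"

text \<open>The discrete chain run for a Poisson(\<open>\<Lambda> s\<close>) number of steps, that is \<open>exp (s Q)\<close>. Time 0 is a separate case
  because the Poisson distribution is taken with a positive parameter.\<close>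

definition uniformized :: "real \<Rightarrow> 's \<Rightarrow> 's pmf" where
  "uniformized s x =
     (if 0 < s then bind_pmf (poisson_pmf (\<Lambda> * s)) (\<lambda>k. steps k x) else return_pmf x)"

lemma step_prob_nonneg: "x \<in> S \<Longrightarrow> 0 \<le> step_prob x y"
  using rate_nonneg[of x y] exit_rate_le[of x] \<Lambda>_pos
  by (auto simp: step_prob_def q_matrix_def field_simps)

lemma step_prob_has_sum: 
  assumes x: "x \<in> S"
  shows "(step_prob x has_sum 1) UNIV"
proof -
  have "((\<lambda>y. q x y / \<Lambda>) has_sum infsum (q x) (S - {x}) / \<Lambda>) (S - {x})"
    using has_sum_cmult_left[OF has_sum_infsum[OF rate_summable[OF x]], of "1 / \<Lambda>"] by simp
  then have "(step_prob x has_sum infsum (q x) (S - {x}) / \<Lambda>) (S - {x})"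
    by (rule has_sum_cong[THEN iffD1, rotated]) (auto simp: step_prob_def q_matrix_def)
  moreover have "(step_prob x has_sum (1 - infsum (q x) (S - {x}) / \<Lambda>)) {x}"
    by (rule has_sum_finiteI) (use x in \<open>auto simp: step_prob_def q_matrix_def\<close>)
  ultimately have "(step_prob x has_sum
      (infsum (q x) (S - {x}) / \<Lambda> + (1 - infsum (q x) (S - {x}) / \<Lambda>))) ((S - {x}) \<union> {x})"
    by (rule has_sum_Un_disjoint) auto
  then have "(step_prob x has_sum 1) S"
    using x by (simp add: insert_absorb)
  then show ?thesis
    by (rule has_sum_cong_neutral[THEN iffD1, rotated 3]) (auto simp: step_prob_def)
qed

lemma pmf_step: "x \<in> S \<Longrightarrow> pmf (step x) y = step_prob x y"
  unfolding step_def using step_prob_nonneg step_prob_has_sum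
  by (simp add: pmf_embed_pmf_has_sum)

lemma set_pmf_step: "x \<in> S \<Longrightarrow> set_pmf (step x) \<subseteq> S"
  by (auto simp: set_pmf_iff pmf_step step_prob_def split: if_splits)

lemma set_pmf_steps: "x \<in> S \<Longrightarrow> set_pmf (steps k x) \<subseteq> S"
  by (induction k arbitrary: x) (use set_pmf_step in fastforce)+

lemma steps_add: "steps (i + j) x = bind_pmf (steps i x) (steps j)"
proof (induction i arbitrary: x)
  case (Suc i)
  have "steps (i + j) = (\<lambda>w. bind_pmf (steps i w) (steps j))"
    using Suc by blast
  then show ?case by (simp add: bind_assoc_pmf)
qed (simp add: bind_return_pmf)

lemma steps_one: "steps (Suc 0) = step"
proof -
  have zero: "steps 0 = return_pmf" by (simp add: fun_eq_iff)
  show ?thesis by (simp add: fun_eq_iff zero bind_return_pmf')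
qed

lemma steps_Suc_right: "steps (Suc k) x = bind_pmf (steps k x) step"
  using steps_add[of k "Suc 0" x] unfolding steps_one by simp

lemma set_pmf_uniformized: "x \<in> S \<Longrightarrow> set_pmf (uniformized s x) \<subseteq> S"
  using set_pmf_steps by (auto simp: uniformized_def split: if_splits)

lemma uniformized_0: "uniformized 0 = return_pmf"
  by (simp add: uniformized_def fun_eq_iff)

text \<open>Given the numbers of steps made in the two time intervals, the two stretches compose by
  \<open>steps_add\<close>; and the sum of the two independent Poisson numbers is Poisson.\<close>

lemma uniformized_add:
  assumes "0 \<le> s" "0 \<le> u"
  shows "uniformized (s + u) x = bind_pmf (uniformized s x) (uniformized u)"
proof (cases "s = 0 \<or> u = 0")
  case True
  then show ?thesis
    using assms by (auto simp: uniformized_0 bind_return_pmf bind_return_pmf')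
next
  case False
  then have s: "0 < \<Lambda> * s" and u: "0 < \<Lambda> * u" and pos: "0 < s" "0 < u"
    using assms \<Lambda>_pos by auto
  have "bind_pmf (uniformized s x) (uniformized u) =
      bind_pmf (poisson_pmf (\<Lambda> * s)) (\<lambda>i. bind_pmf (steps i x)
        (\<lambda>w. bind_pmf (poisson_pmf (\<Lambda> * u)) (\<lambda>j. steps j w)))"
    using pos by (simp add: uniformized_def[abs_def] bind_assoc_pmf)
  also have "\<dots> = bind_pmf (poisson_pmf (\<Lambda> * s)) (\<lambda>i. bind_pmf (poisson_pmf (\<Lambda> * u))
        (\<lambda>j. steps (i + j) x))"
    by (subst bind_commute_pmf) (simp add: steps_add)
  also have "\<dots> = bind_pmf (bind_pmf (poisson_pmf (\<Lambda> * s))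
        (\<lambda>i. map_pmf ((+) i) (poisson_pmf (\<Lambda> * u)))) (\<lambda>k. steps k x)"
    by (simp add: bind_assoc_pmf bind_map_pmf)
  also have "\<dots> = uniformized (s + u) x"
    using pos unfolding poisson_pmf_add[OF s u] by (simp add: uniformized_def algebra_simps)
  finally show ?thesis ..
qed

text \<open>All analytic facts about the chain come from this expansion, whose coefficients are non-negative.\<close>

lemma uniformized_power_series:
  assumes "0 \<le> s"
  shows "(\<lambda>k. pmf (steps k x) y * \<Lambda> ^ k / fact k * s ^ k) sums (exp (\<Lambda> * s) * pmf (uniformized s x) y)"
proof (cases "s = 0")
  case True
  have "(\<lambda>k. pmf (steps k x) y * \<Lambda> ^ k / fact k * 0 ^ k) sums (pmf (steps 0 x) y * \<Lambda> ^ 0 / fact 0)"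
    by (rule powser_sums_zero)
  with True show ?thesis by (simp add: uniformized_def)
next
  case False
  with assms \<Lambda>_pos have s: "0 < s" "0 < \<Lambda> * s" by auto
  have "(\<lambda>k. pmf (poisson_pmf (\<Lambda> * s)) k * pmf (steps k x) y) sums pmf (uniformized s x) y"
    using s expectation_nat_pmf_sums[of "\<lambda>k. pmf (steps k x) y" 1 "poisson_pmf (\<Lambda> * s)"]
    by (simp add: uniformized_def pmf_bind pmf_le_1)
  then have "(\<lambda>k. exp (\<Lambda> * s) * (pmf (poisson_pmf (\<Lambda> * s)) k * pmf (steps k x) y)) sums
      (exp (\<Lambda> * s) * pmf (uniformized s x) y)"
    by (rule sums_mult)
  moreover have "exp (\<Lambda> * s) * (pmf (poisson_pmf (\<Lambda> * s)) k * pmf (steps k x) y) =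
      pmf (steps k x) y * \<Lambda> ^ k / fact k * s ^ k" for k
    using s by (simp add: Transcendental.exp_minus power_mult_distrib)
  ultimately show ?thesis by simp
qed

text \<open>Term by term in the power series. Hence all laws \<open>P\<^sub>s x\<close> with \<open>s \<le> t\<close> are dominated by a single multiple of
  \<open>P\<^sub>t x\<close>; this replaces uniformity in the starting point in the uniqueness proof.\<close>

lemma exp_mult_uniformized_mono:
  assumes "0 \<le> s" "s \<le> t"
  shows "exp (\<Lambda> * s) * pmf (uniformized s x) y \<le> exp (\<Lambda> * t) * pmf (uniformized t x) y"
  using uniformized_power_series[OF assms(1)] uniformized_power_series[OF order_trans[OF assms]]
  by (rule sums_le[rotated]) (use assms \<Lambda>_pos in \<open>auto intro!: mult_left_mono power_mono divide_right_mono\<close>)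

text \<open>Off the diagonal the series has no constant term, and \<open>h ^ k \<le> h\<close> for the remaining terms. After division by \<open>h\<close>
  the transition probabilities therefore have a summable bound that does not depend on \<open>h\<close>.\<close>

lemma uniformized_offdiagonal_le:
  assumes "0 \<le> h" "h \<le> 1" "y \<noteq> x"
  shows "exp (\<Lambda> * h) * pmf (uniformized h x) y \<le> h * (exp \<Lambda> * pmf (uniformized 1 x) y)"
proof (rule sums_le)
  show "(\<lambda>k. pmf (steps k x) y * \<Lambda> ^ k / fact k * h ^ k) sums (exp (\<Lambda> * h) * pmf (uniformized h x) y)"
    by (rule uniformized_power_series[OF assms(1)])
  show "(\<lambda>k. h * (pmf (steps k x) y * \<Lambda> ^ k / fact k)) sums (h * (exp \<Lambda> * pmf (uniformized 1 x) y))"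
    using sums_mult[OF uniformized_power_series[of 1 x y], of h] by simp
  fix k
  show "pmf (steps k x) y * \<Lambda> ^ k / fact k * h ^ k \<le> h * (pmf (steps k x) y * \<Lambda> ^ k / fact k)"
  proof (cases k)
    case 0
    then show ?thesis using assms by simp
  next
    case (Suc m)
    have "h ^ k \<le> h"
      using assms power_decreasing[of 1 k h] Suc by simp
    then show ?thesis
      using \<Lambda>_pos by (subst mult.commute[of h]) (intro mult_left_mono, auto)
  qed
qed

text \<open>The derivative of \<open>exp (- \<Lambda> s)\<close> times the power series is its linear coefficient minus \<open>\<Lambda>\<close> times its constant
  coefficient, which is \<open>\<Lambda> (I + Q / \<Lambda>) - \<Lambda> I = Q\<close>.\<close>

lemma uniformized_derivative:
  assumes x: "x \<in> S" and y: "y \<in> S"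
  shows "((\<lambda>h. pmf (uniformized h x) y) has_real_derivative q_matrix S q x y) (at_right 0)"
proof -
  define c where "c = (\<lambda>k. pmf (steps k x) y * \<Lambda> ^ k / fact k)"
  have summable: "summable (\<lambda>k. c k * s ^ k)" for s
  proof (rule summable_comparison_test')
    show "summable (\<lambda>k. (\<Lambda> * \<bar>s\<bar>) ^ k / fact k)"
      using summable_exp[of "\<Lambda> * \<bar>s\<bar>"] by (simp add: field_simps)
    show "norm (c k * s ^ k) \<le> (\<Lambda> * \<bar>s\<bar>) ^ k / fact k" if "0 \<le> k" for k
      using \<Lambda>_pos mult_right_mono[OF pmf_le_1[of "steps k x" y], of "\<Lambda> ^ k * \<bar>s\<bar> ^ k / fact k"]
      by (simp add: c_def abs_mult power_abs power_mult_distrib)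
  qed
  have "((\<lambda>s. \<Sum>k. c k * s ^ k) has_real_derivative (\<Sum>k. diffs c k * 0 ^ k)) (at 0)"
    by (rule termdiffs_strong_converges_everywhere[OF summable])
  then have "((\<lambda>s. \<Sum>k. c k * s ^ k) has_real_derivative c 1) (at 0)"
    by (simp add: diffs_def)
  then have "((\<lambda>s. exp (- (\<Lambda> * s)) * (\<Sum>k. c k * s ^ k)) has_real_derivative c 1 - \<Lambda> * c 0) (at 0)"
    by (auto intro!: derivative_eq_intros)
  moreover have "c 1 - \<Lambda> * c 0 = q_matrix S q x y"
    using x y \<Lambda>_pos by (auto simp: c_def steps_one pmf_step step_prob_def field_simps simp del: steps.simps(2))
  ultimately have deriv: "((\<lambda>s. exp (- (\<Lambda> * s)) * (\<Sum>k. c k * s ^ k)) has_real_derivative q_matrix S q x y)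
      (at 0 within {0..})"
    by (metis DERIV_subset subset_UNIV)
  have "((\<lambda>h. pmf (uniformized h x) y) has_real_derivative q_matrix S q x y) (at 0 within {0..})"
  proof (rule has_field_derivative_transform_within[OF deriv zero_less_one])
    fix s :: real assume "s \<in> {0..}"
    then show "exp (- (\<Lambda> * s)) * (\<Sum>k. c k * s ^ k) = pmf (uniformized s x) y"
      using sums_unique[OF uniformized_power_series[of s x y], symmetric]
      by (simp add: c_def Transcendental.exp_minus)
  qed simp
  then show ?thesis
    by (rule DERIV_subset) auto
qed

lemma has_rates_uniformized: "has_rates S q uniformized"
  by (auto simp: has_rates_def rate_summable uniformized_derivative)

lemma markov_semigroup_uniformized: "markov_semigroup S uniformized"
proof -
  have "((\<lambda>h. pmf (uniformized h x) x) \<longlongrightarrow> 1) (at_right 0)" if "x \<in> S" for x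
    using DERIV_continuous[OF uniformized_derivative[OF that that]]
    by (simp add: continuous_within uniformized_0)
  then show ?thesis
    using set_pmf_uniformized by (auto simp: markov_semigroup_def uniformized_0 uniformized_add)
qed

end

section \<open>Uniqueness of the semigroup\<close>

context bounded_rates begin

text \<open>The escape probability is subadditive in time, since a chain that is at \<open>x\<close> at times \<open>s\<close> and \<open>s + u\<close> covers
  part of the event of being at \<open>x\<close> at time \<open>s + u\<close>. A subadditive function lies below its tangent at 0. The
  outcome is a bound, uniform in \<open>x\<close>, for an arbitrary semigroup with the given rates.\<close>

lemma escape_prob_le:
  assumes P': "markov_semigroup S P'" and rates: "has_rates S q P'"
    and x: "x \<in> S" and h: "0 \<le> h"
  shows "1 - pmf (P' h x) x \<le> \<Lambda> * h"
proof (cases "h = 0")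
  case True
  then show ?thesis using P' x by (simp add: markov_semigroup_def)
next
  case False
  with h have h: "0 < h" by simp
  \<comment> \<open>the escape probability\<close>
  define \<psi> where "\<psi> = (\<lambda>s. 1 - pmf (P' s x) x)"
  have psi_0: "\<psi> 0 = 0"
    using P' x by (simp add: \<psi>_def markov_semigroup_def)
  have subadditive: "\<psi> (s + u) \<le> \<psi> s + \<psi> u" if "0 \<le> s" "0 \<le> u" for s u
  proof -
    have "P' (s + u) x = bind_pmf (P' s x) (P' u)"
      using P' x that by (simp add: markov_semigroup_def)
    then have "pmf (P' s x) x * pmf (P' u x) x \<le> pmf (P' (s + u) x) x"
      using pmf_mult_le_pmf_bind by metis
    moreover have "0 \<le> (1 - pmf (P' s x) x) * (1 - pmf (P' u x) x)"
      by (simp add: pmf_le_1)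
    ultimately show ?thesis by (simp add: \<psi>_def algebra_simps)
  qed
  have multiple: "\<psi> (real n * u) \<le> real n * \<psi> u" if "0 \<le> u" for n u
  proof (induction n)
    case (Suc n)
    have "\<psi> (real (Suc n) * u) \<le> \<psi> u + \<psi> (real n * u)"
      using subadditive[of u "real n * u"] that by (simp add: algebra_simps)
    with Suc show ?case by (simp add: algebra_simps)
  qed (simp add: psi_0)
  have to_0: "filterlim (\<lambda>n. h / real (Suc n)) (at_right 0) sequentially"
    unfolding at_within_def
  proof (rule filterlim_inf[THEN iffD2], intro conjI)
    show "(\<lambda>n. h / real (Suc n)) \<longlonglongrightarrow> 0"
      using tendsto_mult_right[OF lim_inverse_n', of h] LIMSEQ_Suc[of "\<lambda>n. h / real n" 0] by (simp add: lim_const_over_n)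
    show "filterlim (\<lambda>n. h / real (Suc n)) (principal ({0<..} - {0})) sequentially"
      using h by (auto simp: filterlim_principal)
  qed
  have "((\<lambda>s. (pmf (P' s x) x - pmf (P' 0 x) x) / (s - 0)) \<longlongrightarrow> q_matrix S q x x) (at_right 0)"
    using rates x by (simp add: has_rates_def has_field_derivative_iff)
  then have "((\<lambda>s. - ((pmf (P' s x) x - pmf (P' 0 x) x) / (s - 0))) \<longlongrightarrow> - q_matrix S q x x) (at_right 0)"
    by (rule tendsto_minus)
  moreover have "(\<lambda>s. - ((pmf (P' s x) x - pmf (P' 0 x) x) / (s - 0))) = (\<lambda>s. \<psi> s / s)"
    using psi_0 by (auto simp: \<psi>_def fun_eq_iff minus_divide_left)
  ultimately have "((\<lambda>s. \<psi> s / s) \<longlongrightarrow> - q_matrix S q x x) (at_right 0)" by simp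
  then have "(\<lambda>n. \<psi> (h / real (Suc n)) / (h / real (Suc n))) \<longlonglongrightarrow> - q_matrix S q x x"
    using to_0 by (rule filterlim_compose)
  then have "(\<lambda>n. h * (\<psi> (h / real (Suc n)) / (h / real (Suc n)))) \<longlonglongrightarrow> h * - q_matrix S q x x"
    by (rule tendsto_mult_left)
  moreover have "\<psi> h \<le> h * (\<psi> (h / real (Suc n)) / (h / real (Suc n)))" for n
    using multiple[of "h / real (Suc n)" "Suc n"] h by (simp add: mult.commute)
  ultimately have "\<psi> h \<le> h * - q_matrix S q x x"
    by (intro LIMSEQ_le_const) auto
  also have "\<dots> \<le> h * \<Lambda>"
    using exit_rate_le[OF x] h by (intro mult_left_mono) (auto simp: q_matrix_def)
  finally show ?thesis by (simp add: \<psi>_def mult.commute)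
qed

text \<open>The mass by which the row of \<^term>\<open>P'\<close> falls short of that of the uniformized chain; for two probability vectors
  this is their total variation distance.\<close>

definition deficit :: "(real \<Rightarrow> 's \<Rightarrow> 's pmf) \<Rightarrow> real \<Rightarrow> 's \<Rightarrow> real" where
  "deficit P' h x = (\<integral>y. max 0 (pmf (uniformized h x) y - pmf (P' h x) y) \<partial>count_space UNIV)"

lemma integrable_positive_part:
  "integrable (count_space UNIV) (\<lambda>y. max 0 (pmf p y - pmf r y))"
  by (intro Bochner_Integration.integrable_max Bochner_Integration.integrable_diff integrable_pmf) simp

lemma deficit_nonneg: "0 \<le> deficit P' h x"
  by (simp add: deficit_def)

lemma deficit_le_1: "deficit P' h x \<le> 1"
proof -
  have "deficit P' h x \<le> (\<integral>y. pmf (uniformized h x) y \<partial>count_space UNIV)"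
    unfolding deficit_def by (intro integral_mono integrable_positive_part integrable_pmf) simp
  then show ?thesis by (simp add: integral_pmf)
qed

lemma expectation_diff_le_deficit:
  assumes g: "\<And>y. 0 \<le> g y" "\<And>y. g y \<le> 1"
  shows "measure_pmf.expectation (uniformized h x) g - measure_pmf.expectation (P' h x) g
     \<le> deficit P' h x"
proof -
  have int: "integrable (count_space UNIV) (\<lambda>y. pmf p y * g y)" for p
    by (rule integrable_pmf_mult_bounded[where B = 1]) (use g in \<open>simp add: abs_of_nonneg\<close>)
  have "measure_pmf.expectation (uniformized h x) g - measure_pmf.expectation (P' h x) g =
      (\<integral>y. pmf (uniformized h x) y * g y - pmf (P' h x) y * g y \<partial>count_space UNIV)"
    unfolding expectation_pmf_count_space by (simp add: int)
  also have "\<dots> \<le> deficit P' h x"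
    unfolding deficit_def
  proof (intro integral_mono Bochner_Integration.integrable_diff int integrable_positive_part)
    fix y
    have "(pmf (uniformized h x) y - pmf (P' h x) y) * g y
        \<le> max 0 (pmf (uniformized h x) y - pmf (P' h x) y) * g y"
      using g by (intro mult_right_mono) auto
    also have "\<dots> \<le> max 0 (pmf (uniformized h x) y - pmf (P' h x) y)"
      using g by (intro mult_left_le) auto
    finally show "pmf (uniformized h x) y * g y - pmf (P' h x) y * g y
        \<le> max 0 (pmf (uniformized h x) y - pmf (P' h x) y)" 
      by (simp add: algebra_simps)
  qed
  finally show ?thesis .
qed

text \<open>Dominating function for the difference quotients. On the diagonal it comes from \<open>escape_prob_le\<close>, off the
  diagonal from \<open>uniformized_offdiagonal_le\<close>.\<close>

lemma positive_part_le:
  assumes P': "markov_semigroup S P'" and rates: "has_rates S q P'"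
    and x: "x \<in> S" and h: "0 < h" "h \<le> 1"
  shows "max 0 (pmf (uniformized h x) y - pmf (P' h x) y) / h
     \<le> exp \<Lambda> * pmf (uniformized 1 x) y + \<Lambda> * pmf (return_pmf x) y"
proof (cases "y = x")
  case True
  have "pmf (uniformized h x) x - pmf (P' h x) x \<le> \<Lambda> * h"
    using escape_prob_le[OF P' rates x, of h] h pmf_le_1[of "uniformized h x" x] by simp
  then have "max 0 (pmf (uniformized h x) x - pmf (P' h x) x) / h \<le> \<Lambda>"
    using h \<Lambda>_pos by (simp add: field_simps)
  with True show ?thesis by (simp add: add_increasing)
next
  case False
  have "max 0 (pmf (uniformized h x) y - pmf (P' h x) y) \<le> exp (\<Lambda> * h) * pmf (uniformized h x) y"
    using mult_right_mono[of 1 "exp (\<Lambda> * h)" "pmf (uniformized h x) y"] h \<Lambda>_pos pmf_nonneg[of "P' h x" y]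
      pmf_nonneg[of "uniformized h x" y] by (auto simp del: pmf_nonneg)
  also have "\<dots> \<le> h * (exp \<Lambda> * pmf (uniformized 1 x) y)"
    by (rule uniformized_offdiagonal_le) (use h False in auto)
  finally show ?thesis
    using h False by (simp add: field_simps)
qed

lemma deficit_le:
  assumes P': "markov_semigroup S P'" and rates: "has_rates S q P'"
    and x: "x \<in> S" and h: "0 < h" "h \<le> 1"
  shows "deficit P' h x / h \<le> exp \<Lambda> + \<Lambda>"
proof -
  have "deficit P' h x / h = (\<integral>y. max 0 (pmf (uniformized h x) y - pmf (P' h x) y) / h \<partial>count_space UNIV)"
    by (simp add: deficit_def)
  also have "\<dots> \<le> (\<integral>y. exp \<Lambda> * pmf (uniformized 1 x) y + \<Lambda> * pmf (return_pmf x) y \<partial>count_space UNIV)"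
    by (rule integral_mono)
       (auto intro!: Bochner_Integration.integrable_add integrable_mult_right integrable_pmf
         integrable_divide integrable_positive_part positive_part_le[OF assms] simp del: pmf_return)
  also have "\<dots> = exp \<Lambda> + \<Lambda>"
    by (simp add: integrable_pmf integral_pmf del: pmf_return)
  finally show ?thesis .
qed

text \<open>Both semigroups have the same derivative at 0, entry by entry; the dominating function upgrades this to
  convergence of whole rows, but only for each fixed starting point.\<close>

lemma deficit_tendsto_0:
  assumes P': "markov_semigroup S P'" and rates: "has_rates S q P'"
    and x: "x \<in> S" and h: "\<And>n. 0 < h n" "\<And>n. h n \<le> 1" "h \<longlonglongrightarrow> 0"
  shows "(\<lambda>n. deficit P' (h n) x / h n) \<longlonglongrightarrow> 0"
proof -
  let ?f = "\<lambda>s y. max 0 (pmf (uniformized s x) y - pmf (P' s x) y) / s"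
  have to_0: "filterlim h (at_right 0) sequentially"
    unfolding at_within_def
    by (rule filterlim_inf[THEN iffD2]) (use h in \<open>auto simp: filterlim_principal\<close>)
  have "(\<lambda>n. \<integral>y. ?f (h n) y \<partial>count_space UNIV) \<longlonglongrightarrow> (\<integral>y. 0 \<partial>count_space (UNIV :: 's set))"
  proof (rule integral_dominated_convergence)
    show "integrable (count_space UNIV)
        (\<lambda>y. exp \<Lambda> * pmf (uniformized 1 x) y + \<Lambda> * pmf (return_pmf x) y)"
      by (intro Bochner_Integration.integrable_add integrable_mult_right integrable_pmf)
    show "AE y in count_space UNIV. norm (?f (h n) y) \<le>
        exp \<Lambda> * pmf (uniformized 1 x) y + \<Lambda> * pmf (return_pmf x) y" for n
      using positive_part_le[OF P' rates x h(1,2), of n] h(1)[of n]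
      by (intro AE_I2) (simp only: real_norm_def abs_of_nonneg[OF divide_nonneg_pos[OF max.cobounded1]])
    show "AE y in count_space UNIV. (\<lambda>n. ?f (h n) y) \<longlonglongrightarrow> 0"
    proof (rule AE_I2)
      fix y
      show "(\<lambda>n. ?f (h n) y) \<longlonglongrightarrow> 0"
      proof (cases "y \<in> S")
        case False
        have "set_pmf (P' (h n) x) \<subseteq> S" for n
          using P' x less_imp_le[OF h(1)[of n]] unfolding markov_semigroup_def by blast
        then have "pmf (uniformized (h n) x) y = 0" "pmf (P' (h n) x) y = 0" for n
          using set_pmf_uniformized[OF x, of "h n"] False unfolding pmf_eq_0_set_pmf by blast+
        then show ?thesis by simp
      next
        case True
        have "((\<lambda>s. (pmf (p s x) y - pmf (p 0 x) y) / (s - 0)) \<longlongrightarrow> q_matrix S q x y) (at_right 0)"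
          if "has_rates S q p" for p
          using that x True by (simp add: has_rates_def has_field_derivative_iff)
        from tendsto_diff[OF this[OF has_rates_uniformized] this[OF rates]]
        have "((\<lambda>s. (pmf (uniformized s x) y - pmf (P' s x) y) / s) \<longlongrightarrow> 0) (at_right 0)"
          using P' x by (simp add: markov_semigroup_def uniformized_0 diff_divide_distrib)
        from filterlim_compose[OF this to_0]
        have "(\<lambda>n. max 0 ((pmf (uniformized (h n) x) y - pmf (P' (h n) x) y) / h n)) \<longlonglongrightarrow> max 0 0"
          by (intro tendsto_max tendsto_const)
        then show ?thesis
          by (simp add: max_divide_distrib_right less_imp_le[OF h(1)])
      qed
    qed
  qed auto
  then show ?thesis by (simp add: deficit_def)
qed

lemma expectation_uniformized_mono:
  assumes f: "\<And>y. 0 \<le> f y" "\<And>y. f y \<le> B" and s: "0 \<le> s" "s \<le> t"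
  shows "measure_pmf.expectation (uniformized s x) f
     \<le> exp (\<Lambda> * t) * measure_pmf.expectation (uniformized t x) f"
proof -
  have int: "integrable (count_space UNIV) (\<lambda>y. pmf p y * f y)" for p
    by (rule integrable_pmf_mult_bounded[where B = B]) (use f in \<open>simp add: abs_of_nonneg\<close>)
  have "pmf (uniformized s x) y \<le> exp (\<Lambda> * t) * pmf (uniformized t x) y" for y
    using exp_mult_uniformized_mono[OF s, of x y] s \<Lambda>_pos
      mult_right_mono[of 1 "exp (\<Lambda> * s)" "pmf (uniformized s x) y"] by simp
  then have "(\<integral>y. pmf (uniformized s x) y * f y \<partial>count_space UNIV)
      \<le> (\<integral>y. exp (\<Lambda> * t) * (pmf (uniformized t x) y * f y) \<partial>count_space UNIV)"
    by (intro integral_mono int integrable_mult_right)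
       (use f in \<open>auto simp: mult.assoc[symmetric] intro!: mult_right_mono\<close>)
  then show ?thesis
    by (simp add: expectation_pmf_count_space)
qed

text \<open>Replace the steps of length \<open>h\<close> of the uniformized chain by steps of \<^term>\<open>P'\<close>, one after the other. A replacement
  after \<open>k\<close> steps costs at most the deficit at the random position reached by then.\<close>

lemma telescoping:
  assumes P': "markov_semigroup S P'" and h: "0 \<le> h" and x: "x \<in> S"
  shows "pmf (uniformized (real m * h) x) y - pmf (P' (real m * h) x) y
     \<le> (\<Sum>k<m. measure_pmf.expectation (uniformized (real k * h) x) (deficit P' h))"
  using x
proof (induction m arbitrary: x)
  case 0
  then show ?case using P' by (simp add: uniformized_0 markov_semigroup_def)
next
  case (Suc m)
  note bounded = integrable_measure_pmf_bounded[where B = 1]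
  define u where "u = real m * h"
  have u: "0 \<le> u" using h by (simp add: u_def)
  have time: "real (Suc m) * h = h + u" by (simp add: u_def algebra_simps)
  have int: "integrable (measure_pmf p) (\<lambda>w. measure_pmf.expectation (uniformized (real k * h) w) (deficit P' h))"
    for p k
    by (intro bounded) (auto simp: abs_of_nonneg deficit_nonneg intro!: measure_pmf.integral_le_const bounded deficit_le_1)
  have "pmf (uniformized (h + u) x) y - pmf (P' (h + u) x) y =
      measure_pmf.expectation (uniformized h x) (\<lambda>w. pmf (uniformized u w) y)
      - measure_pmf.expectation (P' h x) (\<lambda>w. pmf (P' u w) y)"
    using P' Suc.prems h u by (simp add: uniformized_add markov_semigroup_def pmf_bind)
  also have "\<dots> \<le> measure_pmf.expectation (uniformized h x) (\<lambda>w. pmf (uniformized u w) y)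
      - measure_pmf.expectation (uniformized h x) (\<lambda>w. pmf (P' u w) y) + deficit P' h x"
    using expectation_diff_le_deficit[of "\<lambda>w. pmf (P' u w) y" h x P'] by (simp add: pmf_le_1)
  also have "\<dots> = measure_pmf.expectation (uniformized h x) (\<lambda>w. pmf (uniformized u w) y - pmf (P' u w) y)
      + deficit P' h x"
    by (subst Bochner_Integration.integral_diff) (auto intro!: bounded simp: pmf_le_1)
  also have "measure_pmf.expectation (uniformized h x) (\<lambda>w. pmf (uniformized u w) y - pmf (P' u w) y)
      \<le> measure_pmf.expectation (uniformized h x)
          (\<lambda>w. \<Sum>k<m. measure_pmf.expectation (uniformized (real k * h) w) (deficit P' h))"
  proof (rule integral_mono_AE)
    show "integrable (measure_pmf (uniformized h x)) (\<lambda>w. pmf (uniformized u w) y - pmf (P' u w) y)"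
      by (intro Bochner_Integration.integrable_diff bounded) (auto simp: pmf_le_1)
    show "AE w in measure_pmf (uniformized h x). pmf (uniformized u w) y - pmf (P' u w) y
        \<le> (\<Sum>k<m. measure_pmf.expectation (uniformized (real k * h) w) (deficit P' h))"
      using Suc.IH set_pmf_uniformized[OF Suc.prems] by (auto simp: AE_measure_pmf_iff u_def)
  qed (intro Bochner_Integration.integrable_sum int)
  also have "\<dots> = (\<Sum>k<m. measure_pmf.expectation (uniformized h x)
          (\<lambda>w. measure_pmf.expectation (uniformized (real k * h) w) (deficit P' h)))"
    by (rule Bochner_Integration.integral_sum) (rule int)
  also have "\<dots> = (\<Sum>k<m. measure_pmf.expectation (uniformized (real (Suc k) * h) x) (deficit P' h))"
  proof (rule sum.cong)
    fix k
    have "uniformized (real (Suc k) * h) x = bind_pmf (uniformized h x) (uniformized (real k * h))"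
      using uniformized_add[of h "real k * h" x] h by (simp add: algebra_simps)
    then show "measure_pmf.expectation (uniformized h x)
          (\<lambda>w. measure_pmf.expectation (uniformized (real k * h) w) (deficit P' h)) =
        measure_pmf.expectation (uniformized (real (Suc k) * h) x) (deficit P' h)"
      using expectation_bind_pmf[of "deficit P' h" 1 "uniformized h x" "uniformized (real k * h)",
          OF deficit_nonneg deficit_le_1] by simp
  qed simp
  finally show ?case
    unfolding time sum.lessThan_Suc_shift by (simp add: uniformized_0 del: of_nat_Suc)
qed

text \<open>With \<open>m\<close> steps of length \<open>h = s / m\<close>, the telescoping sum is at most \<open>m h = s\<close> times \<open>exp (\<Lambda> s)\<close> times the mean of
  \<open>deficit / h\<close> under the single law \<open>P\<^sub>s x\<close>, because all intermediate laws are dominated by it. That mean tends to 0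
  by dominated convergence. So the uniformized chain lies below \<^term>\<open>P'\<close>, and hence equals it.\<close>

theorem uniformized_unique:
  assumes P': "markov_semigroup S P'" and rates: "has_rates S q P'"
    and s: "0 \<le> s" and x: "x \<in> S"
  shows "P' s x = uniformized s x"
proof (cases "s = 0")
  case True
  then show ?thesis using P' x by (simp add: markov_semigroup_def uniformized_0)
next
  case False
  with s have s: "0 < s" by simp
  \<comment> \<open>The summand \<open>\<lceil>s\<rceil>\<close> keeps the step length at most 1, where the dominating function is valid.\<close>
  define m where "m = (\<lambda>n. Suc n + nat \<lceil>s\<rceil>)"
  define h where "h = (\<lambda>n. s / real (m n))"
  have m: "0 < real (m n)" "s \<le> real (m n)" for n
    using of_nat_ceiling[of s] by (simp_all add: m_def)
  have h_pos: "0 < h n" and h_le: "h n \<le> 1" and h_mult: "real (m n) * h n = s" for n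
    using s m[of n] unfolding h_def by (auto simp: field_simps)
  have h_lim: "h \<longlonglongrightarrow> 0"
    using LIMSEQ_ignore_initial_segment[OF lim_const_over_n[of s], of "Suc (nat \<lceil>s\<rceil>)"]
    by (simp add: h_def m_def)
  have bound: "pmf (uniformized s x) y - pmf (P' s x) y
      \<le> s * exp (\<Lambda> * s) * measure_pmf.expectation (uniformized s x) (\<lambda>w. deficit P' (h n) w / h n)" for n y
  proof -
    have "pmf (uniformized s x) y - pmf (P' s x) y
        \<le> (\<Sum>k<m n. measure_pmf.expectation (uniformized (real k * h n) x) (deficit P' (h n)))"
      using telescoping[OF P' less_imp_le[OF h_pos] x, of "m n" n y] by (simp add: h_mult)
    also have "\<dots> \<le> (\<Sum>k<m n. exp (\<Lambda> * s) * measure_pmf.expectation (uniformized s x) (deficit P' (h n)))"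
    proof (intro sum_mono expectation_uniformized_mono[where B = 1] deficit_nonneg deficit_le_1)
      fix k assume "k \<in> {..<m n}"
      then have "real k * h n \<le> real (m n) * h n"
        using h_pos[of n] by (intro mult_right_mono) auto
      then show "real k * h n \<le> s" by (simp add: h_mult)
    qed (use h_pos[of n] in simp)
    also have "\<dots> = s * exp (\<Lambda> * s) * measure_pmf.expectation (uniformized s x) (\<lambda>w. deficit P' (h n) w / h n)"
      using h_mult[of n] h_pos[of n] by (simp add: field_simps)
    finally show ?thesis .
  qed
  have "(\<lambda>n. measure_pmf.expectation (uniformized s x) (\<lambda>w. deficit P' (h n) w / h n))
      \<longlonglongrightarrow> measure_pmf.expectation (uniformized s x) (\<lambda>w. 0)"
  proof (rule integral_dominated_convergence)
    show "AE w in measure_pmf (uniformized s x). (\<lambda>n. deficit P' (h n) w / h n) \<longlonglongrightarrow> 0"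
      using deficit_tendsto_0[OF P' rates _ h_pos h_le h_lim] set_pmf_uniformized[OF x]
      by (auto simp: AE_measure_pmf_iff)
    show "AE w in measure_pmf (uniformized s x). norm (deficit P' (h n) w / h n) \<le> exp \<Lambda> + \<Lambda>" for n
      using deficit_le[OF P' rates _ h_pos h_le] set_pmf_uniformized[OF x] h_pos[of n]
      by (auto simp: AE_measure_pmf_iff deficit_nonneg abs_of_nonneg)
  qed auto
  then have "(\<lambda>n. s * exp (\<Lambda> * s) *
      measure_pmf.expectation (uniformized s x) (\<lambda>w. deficit P' (h n) w / h n)) \<longlonglongrightarrow> s * exp (\<Lambda> * s) * 0"
    by (intro tendsto_mult_left) simp
  then have "pmf (uniformized s x) y - pmf (P' s x) y \<le> s * exp (\<Lambda> * s) * 0" for y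
    by (rule LIMSEQ_le_const) (use bound in auto)
  then show ?thesis
    by (intro pmf_eq_of_le[symmetric]) simp
qed

end

section \<open>Reversibility and the associated processes\<close>

context bounded_rates begin

lemma step_reversible:
  assumes balance: "\<And>x y. x \<in> S \<Longrightarrow> y \<in> S \<Longrightarrow> x \<noteq> y \<Longrightarrow> p x * q x y = p y * q y x"
    and "x \<in> S" "y \<in> S"
  shows "p x * pmf (step x) y = p y * pmf (step y) x"
  using assms(2,3) balance[of x y] by (auto simp: pmf_step step_prob_def q_matrix_def)

text \<open>Symmetry with respect to \<^term>\<open>p\<close> passes to powers: in the induction step the first step of one path becomes the
  last step of the reversed path, which is why \<open>steps_Suc_right\<close> is needed.\<close>

lemma steps_reversible:
  assumes balance: "\<And>x y. x \<in> S \<Longrightarrow> y \<in> S \<Longrightarrow> x \<noteq> y \<Longrightarrow> p x * q x y = p y * q y x"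
    and "x \<in> S" "y \<in> S"
  shows "p x * pmf (steps k x) y = p y * pmf (steps k y) x"
  using assms(2,3)
proof (induction k arbitrary: x y)
  case (Suc k)
  have "p x * pmf (steps (Suc k) x) y = (\<integral>w. p x * pmf (step x) w * pmf (steps k w) y \<partial>count_space UNIV)"
    by (simp add: pmf_bind expectation_pmf_count_space mult.assoc)
  also have "\<dots> = (\<integral>w. p y * pmf (steps k y) w * pmf (step w) x \<partial>count_space UNIV)"
  proof (rule Bochner_Integration.integral_cong)
    fix w
    show "p x * pmf (step x) w * pmf (steps k w) y = p y * pmf (steps k y) w * pmf (step w) x"
    proof (cases "w \<in> S")
      case True
      then have "p x * pmf (step x) w * pmf (steps k w) y = p w * pmf (step w) x * pmf (steps k w) y"
        using step_reversible[OF balance Suc.prems(1) True] by simp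
      also have "\<dots> = p w * pmf (steps k w) y * pmf (step w) x" by simp
      also have "\<dots> = p y * pmf (steps k y) w * pmf (step w) x"
        using Suc.IH[OF True Suc.prems(2)] by simp
      finally show ?thesis .
    next
      case False
      then have "pmf (step x) w = 0" "pmf (steps k y) w = 0"
        using set_pmf_step[OF Suc.prems(1)] set_pmf_steps[OF Suc.prems(2), of k]
        unfolding pmf_eq_0_set_pmf by blast+
      then show ?thesis by simp
    qed
  qed simp
  also have "\<dots> = p y * pmf (steps (Suc k) y) x"
    unfolding steps_Suc_right by (simp add: pmf_bind expectation_pmf_count_space mult.assoc)
  finally show ?case .
qed (auto split: split_indicator)

lemma uniformized_reversible:
  assumes balance: "\<And>x y. x \<in> S \<Longrightarrow> y \<in> S \<Longrightarrow> x \<noteq> y \<Longrightarrow> p x * q x y = p y * q y x"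
  shows "reversible_measure S uniformized p"
  unfolding reversible_measure_def
proof (intro allI impI ballI)
  fix s x y assume s: "0 \<le> (s :: real)" and x: "x \<in> S" and y: "y \<in> S"
  show "p x * pmf (uniformized s x) y = p y * pmf (uniformized s y) x"
  proof (cases "s = 0")
    case False
    have "p x * pmf (uniformized s x) y =
        measure_pmf.expectation (poisson_pmf (\<Lambda> * s)) (\<lambda>k. p x * pmf (steps k x) y)"
      using s False by (simp add: uniformized_def pmf_bind)
    also have "\<dots> = measure_pmf.expectation (poisson_pmf (\<Lambda> * s)) (\<lambda>k. p y * pmf (steps k y) x)"
      using steps_reversible[OF balance x y] by simp
    also have "\<dots> = p y * pmf (uniformized s y) x"
      using s False by (simp add: uniformized_def pmf_bind)
    finally show ?thesis .
  qed (auto simp: uniformized_0 split: split_indicator)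
qed

end

lemma pmf_has_sum_1:
  assumes "set_pmf r \<subseteq> S"
  shows "(pmf r has_sum 1) S"
proof -
  have "(pmf r has_sum 1) UNIV"
    using has_sum_expectation_pmf[of "\<lambda>_. 1" 1 r] by simp
  then show ?thesis
    by (rule has_sum_cong_neutral[THEN iffD1, rotated 3]) (use assms in \<open>auto simp: set_pmf_iff\<close>)
qed

text \<open>By reversibility the sum over the starting points is a sum over the end points of the
  chain started in \<^term>\<open>y\<close>.\<close>

lemma stationary_of_reversible:
  assumes P: "markov_semigroup S P" and rev: "reversible_measure S P p"
  shows "stationary_measure S P p"
  unfolding stationary_measure_def
proof (intro allI impI ballI)
  fix s y assume s: "0 \<le> (s :: real)" and y: "y \<in> S"
  have "((\<lambda>x. p y * pmf (P s y) x) has_sum p y * 1) S"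
    by (intro has_sum_cmult_right pmf_has_sum_1) (use P s y in \<open>simp add: markov_semigroup_def\<close>)
  then show "((\<lambda>x. p x * pmf (P s x) y) has_sum p y) S"
    using rev s y by (subst has_sum_cong[of S _ "\<lambda>x. p y * pmf (P s y) x"])
      (auto simp: reversible_measure_def)
qed

text \<open>Countability of the state space lets the one-dimensional marginals be computed by summing over the
  initial state.\<close>

locale reversible_markov_process =
  fixes S :: "'s set" and P :: "real \<Rightarrow> 's \<Rightarrow> 's pmf" and p :: "'s \<Rightarrow> real"
    and M :: "'w measure" and X :: "real \<Rightarrow> 'w \<Rightarrow> 's"
  assumes countable_S: "countable S"
    and reversible: "reversible_measure S P p"
    and stationary: "stationary_measure S P p"
    and markov: "markov_process S P p M X"
begin

sublocale prob_space M
  using markov by (simp add: markov_process_def)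

lemma X_measurable: "0 \<le> u \<Longrightarrow> X u \<in> measurable M (count_space S)"
  using markov by (simp add: markov_process_def)

lemma path_prob_empty: "path_prob M Y {} c = 1"
  by (simp add: path_prob_def prob_space)

lemma path_prob_step:
  assumes "finite J" "J \<subseteq> {0..u}" "u \<in> J" "u < v" "\<And>w. w \<in> insert v J \<Longrightarrow> c w \<in> S"
  shows "path_prob M X (insert v J) c = path_prob M X J c * pmf (P (v - u) (c u)) (c v)"
  using markov assms unfolding markov_process_def by blast

lemma state_event_measurable: "0 \<le> u \<Longrightarrow> {\<omega> \<in> space M. X u \<omega> = x} \<in> sets M"
proof -
  assume u: "0 \<le> u"
  have "{\<omega> \<in> space M. X u \<omega> = x} = X u -` ({x} \<inter> S) \<inter> space M"
    using measurable_space[OF X_measurable[OF u]] by auto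
  then show ?thesis
    using measurable_sets[OF X_measurable[OF u], of "{x} \<inter> S"] by simp
qed

lemma path_prob_singleton:
  assumes u: "0 \<le> u" and cu: "c u \<in> S"
  shows "path_prob M X {u} c = p (c u)"
proof (cases "u = 0")
  case True
  then show ?thesis using markov cu by (simp add: path_prob_def markov_process_def)
next
  case False
  with u have u: "0 < u" by simp
  let ?A = "\<lambda>x. {\<omega> \<in> space M. X 0 \<omega> = x} \<inter> {\<omega> \<in> space M. X u \<omega> = c u}"
  have joint: "measure M (?A x) = p x * pmf (P u x) (c u)" if x: "x \<in> S" for x
  proof -
    let ?c = "c(0 := x)"
    have "path_prob M X (insert u {0}) ?c = path_prob M X {0} ?c * pmf (P (u - 0) (?c 0)) (?c u)"
      by (rule path_prob_step) (use u cu x in auto)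
    moreover have "path_prob M X (insert u {0}) ?c = measure M (?A x)"
      unfolding path_prob_def by (rule arg_cong[where f = "measure M"]) (use u in auto)
    moreover have "path_prob M X {0} ?c = p x"
      using markov x by (simp add: path_prob_def markov_process_def)
    ultimately show ?thesis using u by simp
  qed
  have sum: "((\<lambda>x. measure M (?A x)) has_sum p (c u)) S"
    using stationary u cu by (subst has_sum_cong[OF joint]) (simp_all add: stationary_measure_def)
  have "ennreal (measure M (\<Union>x\<in>S. ?A x)) = (\<integral>\<^sup>+x. ennreal (measure M (?A x)) \<partial>count_space S)"
    unfolding emeasure_eq_measure[symmetric]
    by (rule emeasure_UN_countable)
       (use countable_S u in \<open>auto simp: disjoint_family_on_def intro!: sets.Int state_event_measurable\<close>)
  also have "\<dots> = ennreal (p (c u))"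
    by (rule nn_integral_count_space_has_sum[OF sum]) simp
  finally have "measure M (\<Union>x\<in>S. ?A x) = p (c u)"
    using has_sum_nonneg[OF sum] by (simp add: ennreal_inj)
  moreover have "(\<Union>x\<in>S. ?A x) = {\<omega> \<in> space M. \<forall>w\<in>{u}. X w \<omega> = c w}"
    using measurable_space[OF X_measurable[of 0]] by auto
  ultimately show ?thesis by (simp add: path_prob_def)
qed

text \<open>The Markov property run backwards: by reversibility the same transition function describes how an earlier
  observation is added to a path.\<close>

lemma path_prob_prepend:
  assumes "finite J" "J \<noteq> {}" "0 \<le> w" "\<And>u. u \<in> J \<Longrightarrow> w < u" "\<And>u. u \<in> insert w J \<Longrightarrow> c u \<in> S"
  shows "path_prob M X (insert w J) c = pmf (P (Min J - w) (c (Min J))) (c w) * path_prob M X J c"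
  using assms
proof (induction J rule: finite_linorder_max_induct)
  case (insert v J)
  have J_nonneg: "0 \<le> u" if "u \<in> insert v J" for u
    using insert.prems(2) insert.prems(3)[OF that] by simp
  show ?case
  proof (cases "J = {}")
    case True
    have w: "0 \<le> w" "w < v" "c v \<in> S" "c w \<in> S" using insert.prems by auto
    have "path_prob M X (insert v {w}) c = path_prob M X {w} c * pmf (P (v - w) (c w)) (c v)"
      by (rule path_prob_step) (use w in auto)
    also have "\<dots> = p (c w) * pmf (P (v - w) (c w)) (c v)"
      using w by (simp add: path_prob_singleton)
    also have "\<dots> = p (c v) * pmf (P (v - w) (c v)) (c w)"
      using reversible w by (simp add: reversible_measure_def)
    also have "p (c v) = path_prob M X {v} c"
      using w by (simp add: path_prob_singleton)
    finally show ?thesis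
      using True by (simp add: insert_commute mult.commute)
  next
    case False
    let ?m = "Max J"
    have m: "?m \<in> J" "?m < v" using False insert.hyps by auto
    have "path_prob M X (insert v (insert w J)) c =
        path_prob M X (insert w J) c * pmf (P (v - ?m) (c ?m)) (c v)"
      using m insert.prems insert.hyps J_nonneg
      by (intro path_prob_step) (auto simp: less_imp_le order_trans)
    also have "path_prob M X (insert w J) c = pmf (P (Min J - w) (c (Min J))) (c w) * path_prob M X J c"
      using insert.prems False by (intro insert.IH) auto
    also have "\<dots> * pmf (P (v - ?m) (c ?m)) (c v) =
        pmf (P (Min J - w) (c (Min J))) (c w) * path_prob M X (insert v J) c"
      using m insert.prems insert.hyps J_nonneg
      by (subst path_prob_step[where u = ?m]) auto
    also have "Min J = Min (insert v J)"
      using False insert.hyps m by (simp add: min_absorb2 less_imp_le order.strict_trans1 Min_le)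
    finally show ?thesis by (simp add: insert_commute)
  qed
qed simp

lemma path_prob_reflect: "path_prob M (\<lambda>u. X (T - u)) J c = path_prob M X ((\<lambda>u. T - u) ` J) (\<lambda>u. c (T - u))"
  by (simp add: path_prob_def)

lemma path_prob_shift: "path_prob M (\<lambda>u. X (u + h)) J c = path_prob M X ((\<lambda>u. u + h) ` J) (\<lambda>u. c (u - h))"
  by (simp add: path_prob_def)

text \<open>Adding a latest time to \<^term>\<open>J\<close> adds an earliest time to the reflected set. The two sides then change by the same
  factor, by \<open>path_prob_step\<close> and \<open>path_prob_prepend\<close>.\<close>

lemma reversible_process: "reversible_process S M X"
  unfolding reversible_process_def path_prob_reflect
proof (intro allI impI, elim conjE)
  fix T and J :: "real set" and c :: "real \<Rightarrow> 's"
  assume "finite J" "J \<subseteq> {0..T}" "\<forall>u\<in>J. c u \<in> S"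
  then show "path_prob M X ((\<lambda>u. T - u) ` J) (\<lambda>u. c (T - u)) = path_prob M X J c"
  proof (induction J rule: finite_linorder_max_induct)
    case (insert v J)
    show ?case
    proof (cases "J = {}")
      case True
      then show ?thesis using insert.prems by (simp add: path_prob_singleton)
    next
      case False
      let ?m = "Max J" and ?J = "(\<lambda>u. T - u) ` J"
      have m: "?m \<in> J" "?m < v" using False insert.hyps by auto
      have Min: "Min ?J = T - ?m"
        using insert.hyps m by (intro Min_eqI) auto
      have "path_prob M X (insert (T - v) ?J) (\<lambda>u. c (T - u)) =
          pmf (P (Min ?J - (T - v)) (c (T - Min ?J))) (c (T - (T - v))) *
          path_prob M X ?J (\<lambda>u. c (T - u))"
        by (rule path_prob_prepend) (use False insert.hyps insert.prems in auto)
      also have "\<dots> = path_prob M X J c * pmf (P (v - ?m) (c ?m)) (c v)"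
        using insert.IH insert.prems by (simp add: Min)
      also have "\<dots> = path_prob M X (insert v J) c"
        by (rule path_prob_step[symmetric]) (use m insert.hyps insert.prems in auto)
      finally show ?thesis by simp
    qed
  qed (simp add: path_prob_empty)
qed

lemma stationary_process: "stationary_process S M X"
  unfolding stationary_process_def path_prob_shift
proof (intro allI impI, elim conjE)
  fix h :: real and J :: "real set" and c :: "real \<Rightarrow> 's"
  assume h: "0 \<le> h" and "finite J" "J \<subseteq> {0..}" "\<forall>u\<in>J. c u \<in> S"
  from this(2-) show "path_prob M X ((\<lambda>u. u + h) ` J) (\<lambda>u. c (u - h)) = path_prob M X J c"
  proof (induction J rule: finite_linorder_max_induct)
    case (insert v J)
    show ?case
    proof (cases "J = {}")
      case True
      then show ?thesis using insert.prems h by (simp add: path_prob_singleton)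
    next
      case False
      let ?m = "Max J" and ?J = "(\<lambda>u. u + h) ` J"
      have m: "?m \<in> J" "?m < v" using False insert.hyps by auto
      have "path_prob M X (insert (v + h) ?J) (\<lambda>u. c (u - h)) =
          path_prob M X ?J (\<lambda>u. c (u - h)) *
          pmf (P ((v + h) - (?m + h)) (c ((?m + h) - h))) (c ((v + h) - h))"
        by (rule path_prob_step) (use h m insert.hyps insert.prems in auto)
      also have "\<dots> = path_prob M X J c * pmf (P (v - ?m) (c ?m)) (c v)"
        using insert.IH insert.prems by simp
      also have "\<dots> = path_prob M X (insert v J) c"
        by (rule path_prob_step[symmetric]) (use m insert.hyps insert.prems in auto)
      finally show ?thesis by simp
    qed
  qed (simp add: path_prob_empty)
qed

end

section \<open>Detailed balance for the coagulation-fragmentation dynamics\<close>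

lemma boltzmann_add_one:
  assumes V: "\<And>u. V u \<noteq> - \<infinity>" and j: "1 \<le> j"
  shows "boltzmann V L (j + 1) x = boltzmann V L j x * boltzmann V L 1 x"
  using V[of "scaled L x"] j
  by (cases "V (scaled L x)")
     (simp_all add: boltzmann_def Defs.exp_minus_def exp_add[symmetric] algebra_simps)

definition site_weight :: "(nat \<Rightarrow> real) \<Rightarrow> nat multiset \<Rightarrow> real" where
  "site_weight c M = (\<Prod>j\<in>set_mset M. 1 / fact (count M j) * c j ^ count M j)"

text \<open>Written without division, since \<^term>\<open>c j\<close> may vanish. Detailed balance for all three kinds of transition follows
  from this one identity, because every transition removes and adds clusters one at a time.\<close>

lemma site_weight_add_mset:
  "site_weight c (add_mset j M) * (real (count M j) + 1) = c j * site_weight c M"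
proof -
  let ?f = "\<lambda>M i. 1 / fact (count M i) * c i ^ count M i"
  have "site_weight c M = (\<Prod>i\<in>insert j (set_mset M). ?f M i)"
    unfolding site_weight_def by (rule prod.mono_neutral_left) (auto simp: not_in_iff)
  also have "\<dots> = ?f M j * (\<Prod>i\<in>set_mset M - {j}. ?f M i)"
    by (rule prod.insert_remove) simp
  finally have M: "site_weight c M = ?f M j * (\<Prod>i\<in>set_mset M - {j}. ?f M i)" .
  have "site_weight c (add_mset j M) = ?f (add_mset j M) j * (\<Prod>i\<in>set_mset M - {j}. ?f (add_mset j M) i)"
    unfolding site_weight_def set_mset_add_mset_insert by (rule prod.insert_remove) simp
  also have "(\<Prod>i\<in>set_mset M - {j}. ?f (add_mset j M) i) = (\<Prod>i\<in>set_mset M - {j}. ?f M i)"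
    by (rule prod.cong) auto
  finally show ?thesis
    unfolding M by (simp add: divide_simps mult_ac add_ac)
qed

lemma gibbs_weight_altdef:
  assumes "finite A" and "{x. lam x \<noteq> {#}} \<subseteq> A"
  shows "gibbs_weight V L \<theta> lam =
    (\<Prod>x\<in>A. site_weight (\<lambda>j. \<theta> j / real j * boltzmann V L j x) (lam x))"
  unfolding gibbs_weight_def site_weight_def[symmetric]
  by (rule prod.mono_neutral_left) (use assms in \<open>auto simp: site_weight_def\<close>)

lemma gibbs_weight_add_cluster:
  assumes "finite {x. lam x \<noteq> {#}}"
  shows "gibbs_weight V L \<theta> (lam(x := add_mset j M)) * (real (count M j) + 1) =
    \<theta> j / real j * boltzmann V L j x * gibbs_weight V L \<theta> (lam(x := M))"
proof -
  let ?A = "insert x {x. lam x \<noteq> {#}}"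
  let ?w = "\<lambda>x. site_weight (\<lambda>j. \<theta> j / real j * boltzmann V L j x)"
  have *: "gibbs_weight V L \<theta> (lam(x := K)) = ?w x K * (\<Prod>y\<in>?A - {x}. ?w y (lam y))" for K
  proof -
    have "gibbs_weight V L \<theta> (lam(x := K)) = (\<Prod>y\<in>?A. ?w y ((lam(x := K)) y))"
      by (rule gibbs_weight_altdef) (use assms in auto)
    also have "\<dots> = ?w x K * (\<Prod>y\<in>?A - {x}. ?w y ((lam(x := K)) y))"
      using assms by (subst prod.remove[of _ x]) auto
    also have "(\<Prod>y\<in>?A - {x}. ?w y ((lam(x := K)) y)) = (\<Prod>y\<in>?A - {x}. ?w y (lam y))"
      by (rule prod.cong) auto
    finally show ?thesis .
  qed
  show ?thesis
    unfolding * using arg_cong[OF site_weight_add_mset[of "\<lambda>j. \<theta> j / real j * boltzmann V L j x" j M],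
        of "\<lambda>v. v * (\<Prod>y\<in>?A - {x}. ?w y (lam y))"]
    by (simp only: mult_ac)
qed

lemma spatial_partitions_finite_support: "lam \<in> spatial_partitions n \<Longrightarrow> finite {x. lam x \<noteq> {#}}"
  by (simp add: spatial_partitions_def)

text \<open>A configuration with finite support is determined by a finite list of its clusters with their sites.\<close>

lemma countable_spatial_partitions: "countable (spatial_partitions n :: ('d::finite) config set)"
proof -
  define f :: "((int ^ 'd) \<times> nat) list \<Rightarrow> 'd config" where
    "f = (\<lambda>l x. mset (map snd (filter (\<lambda>p. fst p = x) l)))"
  have "\<exists>l. lam = f l" if "finite A" "{x. lam x \<noteq> {#}} \<subseteq> A" for A lam
    using that
  proof (induction A arbitrary: lam)
    case empty
    then have "lam = f []" by (auto simp: f_def fun_eq_iff)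
    then show ?case ..
  next
    case (insert a A)
    have "{x. (lam(a := {#})) x \<noteq> {#}} \<subseteq> A" using insert.prems by auto
    from insert.IH[OF this] obtain l where l: "lam(a := {#}) = f l" by blast
    obtain xs where xs: "mset xs = lam a" using ex_mset by blast
    have "lam = f (map (Pair a) xs @ l)"
    proof
      fix x
      have "f (map (Pair a) xs @ l) x = (if x = a then mset xs else {#}) + f l x"
        by (simp add: f_def filter_map o_def flip: mset_map)
      also have "\<dots> = lam x"
        using xs unfolding l[symmetric] by simp
      finally show "lam x = f (map (Pair a) xs @ l) x" ..
    qed
    then show ?case ..
  qed
  then have "spatial_partitions n \<subseteq> range f"
    using spatial_partitions_finite_support by blast
  then show ?thesis
    by (rule countable_subset) simp
qed

fun reverse_event :: "'x event \<Rightarrow> 'x event" where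
  "reverse_event (Coag x j) = Frag x (j + 1)"
| "reverse_event (Frag x j) = Coag x (j - 1)"
| "reverse_event (Jump x y) = Jump y x"

lemma admissible_reverse_event: "admissible e \<Longrightarrow> admissible (reverse_event e)"
  by (cases e) auto

lemma reverse_reverse_event: "admissible e \<Longrightarrow> reverse_event (reverse_event e) = e"
  by (cases e) auto

text \<open>Let \<open>N\<close> be the content of the site without the clusters that take part in the event. Expressed through the weight
  with \<open>N\<close> at that site, the flow of a coagulation is \<open>a\<^sub>j c\<^sub>j c\<^sub>1\<close> and that of the fragmentation undoing it
  is \<open>b\<^sub>j\<^sub>+\<^sub>1 c\<^sub>j\<^sub>+\<^sub>1\<close>, where \<open>c\<^sub>j = \<theta>\<^sub>j / j exp (- j V)\<close>; these agree by the assumption on \<open>a\<close> and \<open>b\<close>.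
  For jumps the same computation leaves the assumed symmetry of \<open>t\<close>. A non-zero rate guarantees that the
  clusters to be removed are present, so that multiset difference does not truncate.\<close>

lemma event_balance:
  fixes V :: "real ^ ('d::finite) \<Rightarrow> ereal" and t :: "int ^ 'd \<Rightarrow> int ^ 'd \<Rightarrow> real"
  assumes V: "\<And>u. V u \<noteq> - \<infinity>"
    and balance: "\<And>j. 1 \<le> j \<Longrightarrow>
        a j * (\<theta> j / real j) * \<theta> 1 = b (j + 1) * (\<theta> (j + 1) / real (j + 1))"
    and t_balance: "\<And>x y. boltzmann V L 1 x * t x y = boltzmann V L 1 y * t y x"
    and fin: "finite {x. lam x \<noteq> {#}}" and e: "admissible e" and rate: "event_rate a b t e lam \<noteq> 0"
  shows "target (reverse_event e) (target e lam) = lam"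
    and "gibbs_weight V L \<theta> lam * event_rate a b t e lam =
     gibbs_weight V L \<theta> (target e lam) * event_rate a b t (reverse_event e) (target e lam)"
proof -
  let ?w = "gibbs_weight V L \<theta>"
  let ?P = "\<lambda>e lam. target (reverse_event e) (target e lam) = lam \<and>
     ?w lam * event_rate a b t e lam =
     ?w (target e lam) * event_rate a b t (reverse_event e) (target e lam)"
  note add = gibbs_weight_add_cluster[OF fin, of V L \<theta>]
  have coag_frag: "target (Coag x j) (lam(x := add_mset 1 (add_mset j N))) = lam(x := add_mset (j + 1) N)"
      "target (Frag x (j + 1)) (lam(x := add_mset (j + 1) N)) = lam(x := add_mset 1 (add_mset j N))"
      "?w (lam(x := add_mset 1 (add_mset j N))) *
         event_rate a b t (Coag x j) (lam(x := add_mset 1 (add_mset j N))) =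
       ?w (lam(x := add_mset (j + 1) N)) * event_rate a b t (Frag x (j + 1)) (lam(x := add_mset (j + 1) N))"
    if j: "1 \<le> j" for x j N
  proof -
    let ?lam = "lam(x := add_mset 1 (add_mset j N))"
    show "target (Coag x j) ?lam = lam(x := add_mset (j + 1) N)"
      by (simp add: fun_eq_iff)
    show "target (Frag x (j + 1)) (lam(x := add_mset (j + 1) N)) = ?lam"
      by (simp add: fun_eq_iff add_mset_commute)
    \<comment> \<open>This covers \<open>j = 1\<close> too: there the counts are \<open>r - 2\<close> and \<open>r - 1\<close>, and the rate is \<open>a 1 * r * (r - 1)\<close>.\<close>
    have "event_rate a b t (Coag x j) ?lam = a j * (real (count N j) + 1) * (real (count (add_mset j N) 1) + 1)"
      by (simp add: algebra_simps)
    then have "?w ?lam * event_rate a b t (Coag x j) ?lam =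
        a j * (real (count N j) + 1) * (?w ?lam * (real (count (add_mset j N) 1) + 1))"
      by simp
    also have "\<dots> = a j * (\<theta> 1 / real 1 * boltzmann V L 1 x) *
        (?w (lam(x := add_mset j N)) * (real (count N j) + 1))"
      unfolding add[of x 1 "add_mset j N"] by (simp only: mult_ac)
    also have "\<dots> = (a j * (\<theta> j / real j) * \<theta> 1) * (boltzmann V L j x * boltzmann V L 1 x) * ?w (lam(x := N))"
      unfolding add by simp
    also have "\<dots> = b (j + 1) * (\<theta> (j + 1) / real (j + 1) * boltzmann V L (j + 1) x * ?w (lam(x := N)))"
      unfolding balance[OF j] boltzmann_add_one[OF V j] by simp
    also have "\<dots> = b (j + 1) * (?w (lam(x := add_mset (j + 1) N)) * (real (count N (j + 1)) + 1))"
      unfolding add ..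
    finally show "?w ?lam * event_rate a b t (Coag x j) ?lam =
        ?w (lam(x := add_mset (j + 1) N)) * event_rate a b t (Frag x (j + 1)) (lam(x := add_mset (j + 1) N))"
      by simp
  qed
  have "?P e lam"
  proof (cases e)
    case (Coag x j)
    with e have j: "1 \<le> j" by simp
    have "{#1, j#} \<subseteq># lam x"
    proof (cases "j = 1")
      case True
      have "k = 0 \<or> k = 1 \<or> 2 \<le> k" for k :: nat by linarith
      moreover have "a 1 * real (count (lam x) 1) * (real (count (lam x) 1) - 1) \<noteq> 0"
        using rate unfolding Coag True by simp
      ultimately have "2 \<le> count (lam x) 1"
        by (metis diff_self mult_zero_right mult_zero_left of_nat_0 of_nat_1)
      with True show ?thesis by (auto simp: subseteq_mset_def)
    next
      case False
      with rate Coag have "1 \<le> count (lam x) 1" "1 \<le> count (lam x) j"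
        by (auto simp: Suc_le_eq)
      with False show ?thesis by (auto simp: subseteq_mset_def)
    qed
    then obtain N where "lam x = {#1, j#} + N" using mset_subset_eq_exists_conv by blast
    then have lam: "lam(x := add_mset 1 (add_mset j N)) = lam" by (simp add: fun_eq_iff)
    note cf = coag_frag[OF j, of x N, unfolded lam]
    show ?thesis
      unfolding Coag reverse_event.simps cf(1) using cf(2,3) by (rule conjI)
  next
    case (Frag x j)
    with e have j: "1 \<le> j - 1" "j - 1 + 1 = j" by auto
    from rate Frag have "j \<in># lam x" by (simp flip: count_greater_zero_iff)
    then obtain N where "lam x = add_mset j N" by (metis mset_add)
    then have lam: "lam(x := add_mset j N) = lam" by (simp add: fun_eq_iff)
    note cf = coag_frag[OF j(1), of x N, unfolded j(2) lam]
    show ?thesis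
      unfolding Frag reverse_event.simps cf(2) using cf(1) cf(3)[symmetric] by (rule conjI)
  next
    case (Jump x y)
    with e have xy: "x \<noteq> y" by simp
    from rate Jump have "1 \<in># lam x" by (simp flip: count_greater_zero_iff)
    then obtain N where N: "lam x = add_mset 1 N" by (metis mset_add)
    define nu where "nu = lam(x := N)"
    have fin': "finite {x. nu x \<noteq> {#}}"
      by (rule finite_subset[OF _ fin]) (auto simp: nu_def N split: if_splits)
    have lam: "lam = nu(x := add_mset 1 (nu x))" by (simp add: nu_def N fun_eq_iff)
    have mu: "target e lam = nu(y := add_mset 1 (nu y))"
      using xy by (auto simp: Jump nu_def N fun_eq_iff)
    have undone: "target (Jump y x) (nu(y := add_mset 1 (nu y))) = lam"
      using xy by (auto simp: nu_def N fun_eq_iff)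
    have w: "?w (nu(z := add_mset 1 (nu z))) * (real (count (nu z) 1) + 1) =
        \<theta> 1 * boltzmann V L 1 z * ?w nu" for z
      using gibbs_weight_add_cluster[OF fin', of V L \<theta> z 1 "nu z"] by simp
    have "?w lam * event_rate a b t e lam = \<theta> 1 * boltzmann V L 1 x * ?w nu * t x y"
      unfolding w[of x, symmetric] lam[symmetric] by (simp add: Jump nu_def N)
    also have "\<dots> = \<theta> 1 * boltzmann V L 1 y * ?w nu * t y x"
      using t_balance[of x y] by (simp add: algebra_simps)
    also have "\<dots> = ?w (target e lam) * event_rate a b t (Jump y x) (target e lam)"
      unfolding w[of y, symmetric] mu by simp
    finally have weights: "?w lam * event_rate a b t e lam =
        ?w (target e lam) * event_rate a b t (Jump y x) (target e lam)" .
    show ?thesis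
      using undone[folded mu] weights unfolding Jump reverse_event.simps by (rule conjI)
  qed
  then show "target (reverse_event e) (target e lam) = lam"
    and "?w lam * event_rate a b t e lam =
     ?w (target e lam) * event_rate a b t (reverse_event e) (target e lam)"
    by blast+
qed

text \<open>Reversal of events is a bijection between the events leading from \<^term>\<open>lam\<close> to \<^term>\<open>mu\<close> with non-zero flow and
  those leading back, and it preserves the flow.\<close>

lemma transition_rate_balance:
  fixes V :: "real ^ ('d::finite) \<Rightarrow> ereal" and t :: "int ^ 'd \<Rightarrow> int ^ 'd \<Rightarrow> real"
  assumes V: "\<And>u. V u \<noteq> - \<infinity>"
    and balance: "\<And>j. 1 \<le> j \<Longrightarrow>
        a j * (\<theta> j / real j) * \<theta> 1 = b (j + 1) * (\<theta> (j + 1) / real (j + 1))"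
    and t_balance: "\<And>x y. boltzmann V L 1 x * t x y = boltzmann V L 1 y * t y x"
    and fin: "finite {x. lam x \<noteq> {#}}" "finite {x. mu x \<noteq> {#}}"
  shows "gibbs_weight V L \<theta> lam * transition_rate a b t lam mu =
         gibbs_weight V L \<theta> mu * transition_rate a b t mu lam"
proof -
  let ?w = "gibbs_weight V L \<theta>" and ?r = "event_rate a b t"
  let ?E = "\<lambda>lam mu. {e. admissible e \<and> target e lam = mu}"
  let ?A = "\<lambda>lam mu. {e \<in> ?E lam mu. ?w lam * ?r e lam \<noteq> 0}"
  have restrict: "?w lam * transition_rate a b t lam mu = (\<Sum>\<^sub>\<infinity>e\<in>?A lam mu. ?w lam * ?r e lam)" for lam mu
    unfolding transition_rate_def infsum_cmult_right'[symmetric]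
    by (rule infsum_cong_neutral) auto
  have rev: "reverse_event e \<in> ?A mu lam \<and> ?w mu * ?r (reverse_event e) mu = ?w lam * ?r e lam"
    if e: "e \<in> ?A lam mu" and fin: "finite {x. lam x \<noteq> {#}}" for e lam mu
  proof -
    from e have "admissible e" "?r e lam \<noteq> 0" "target e lam = mu" "?w lam * ?r e lam \<noteq> 0" by auto
    with event_balance[OF V balance t_balance fin this(1,2)] show ?thesis
      by (auto simp: admissible_reverse_event)
  qed
  show ?thesis
    unfolding restrict
    by (rule infsum_reindex_bij_witness[where i = reverse_event and j = reverse_event])
       (use rev fin in \<open>auto simp: reverse_reverse_event\<close>)
qed

section \<open>The dynamics on spatial partitions\<close>

lemma size_le_sum_mset: "0 \<notin># M \<Longrightarrow> size M \<le> sum_mset M" for M :: "nat multiset"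
  by (induction M) auto

lemma spatial_partitions_bounds:
  assumes lam: "lam \<in> spatial_partitions n"
  shows "(\<Sum>x | lam x \<noteq> {#}. size (lam x)) \<le> n"
    and "count (lam x) j \<le> n"
    and "j \<in># lam x \<Longrightarrow> 1 \<le> j \<and> j \<le> n"
proof -
  from lam have fin: "finite {x. lam x \<noteq> {#}}" and pos: "\<And>x. 0 \<notin># lam x"
    and total: "(\<Sum>x | lam x \<noteq> {#}. sum_mset (lam x)) = n"
    by (auto simp: spatial_partitions_def)
  show "(\<Sum>x | lam x \<noteq> {#}. size (lam x)) \<le> n"
    unfolding total[symmetric] by (intro sum_mono size_le_sum_mset pos)
  have site: "sum_mset (lam x) \<le> n"
  proof (cases "lam x = {#}")
    case False
    then show ?thesis
      unfolding total[symmetric] using fin by (intro member_le_sum) auto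
  qed simp
  have "count (lam x) j \<le> size (lam x)" by (rule count_le_size)
  also have "\<dots> \<le> n" using size_le_sum_mset[OF pos] site by (rule order_trans)
  finally show "count (lam x) j \<le> n" .
  show "1 \<le> j \<and> j \<le> n" if j: "j \<in># lam x"
  proof
    show "1 \<le> j" using j pos[of x] by (cases j) auto
    have "j \<le> sum_mset (lam x)" using j by (metis le_add1 multi_member_split sum_mset.add_mset)
    then show "j \<le> n" using site by simp
  qed
qed

text \<open>There are at most \<open>n\<close> clusters, all of size at most \<open>n\<close>. The three terms bound coagulation, fragmentation and
  jumps; the final 1 makes the bound positive.\<close>

definition exit_rate_bound :: "(nat \<Rightarrow> real) \<Rightarrow> (nat \<Rightarrow> real) \<Rightarrow> nat \<Rightarrow> real" where
  "exit_rate_bound a b n = real n * (sum a {1..n}) * real n + sum b {2..n} * real n + real n + 1"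

lemma event_rate_nonneg:
  assumes a: "\<And>j. 1 \<le> j \<Longrightarrow> 0 < a j" and b: "\<And>j. 2 \<le> j \<Longrightarrow> 0 < b j"
    and t: "\<And>x y. 0 \<le> t x y" and e: "admissible e"
  shows "0 \<le> event_rate a b t e lam"
proof (cases e)
  case (Coag x j)
  have "0 \<le> real k * (real k - 1)" for k by (cases k) auto
  then have "0 \<le> a 1 * (real (count (lam x) 1) * (real (count (lam x) 1) - 1))"
    using a[of 1] by (simp only: zero_le_mult_iff) auto
  with Coag e a[of j] show ?thesis by (auto simp: mult.assoc)
next
  case (Frag x j)
  with e b[of j] show ?thesis by simp
qed (use t in simp)

text \<open>Although infinitely many events are admissible, coagulation and fragmentation act on the finitely many clusters present,
  and the jump rates of a cluster sum to at most 1. Since all rates are non-negative, a bound for finite sets of events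
  is a bound for the total rate.\<close>

lemma sum_event_rate_le:
  fixes t :: "int ^ ('d::finite) \<Rightarrow> int ^ 'd \<Rightarrow> real"
  assumes a: "\<And>j. 1 \<le> j \<Longrightarrow> 0 < a j" and b: "\<And>j. 2 \<le> j \<Longrightarrow> 0 < b j"
    and t: "\<And>x y. 0 \<le> t x y" and t_sum: "\<And>x. (t x has_sum 1) UNIV"
    and lam: "lam \<in> spatial_partitions n" and F: "finite F" "F \<subseteq> {e. admissible e}"
  shows "(\<Sum>e\<in>F. event_rate a b t e lam) \<le> exit_rate_bound a b n"
proof -
  let ?r = "\<lambda>e. event_rate a b t e lam"
  \<comment> \<open>\<open>C\<close>, \<open>D\<close> and \<open>E\<close> contain all coagulations, fragmentations and jumps in \<open>F\<close> with non-zero rate.\<close>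
  define X where "X = {x. lam x \<noteq> {#}}"
  define Y where "Y = {y. \<exists>x. Jump x y \<in> F}"
  define I where "I = (SIGMA x:X. set_mset (lam x))"
  define I2 where "I2 = (SIGMA x:X. {j. j \<in># lam x \<and> 2 \<le> j})"
  define C where "C = (\<lambda>(x, j). Coag x j) ` I"
  define D where "D = (\<lambda>(x, j). Frag x j) ` I2"
  define E where "E = (\<lambda>(x, y). Jump x y) ` (X \<times> Y)"
  have a_nonneg: "\<And>j. 1 \<le> j \<Longrightarrow> 0 \<le> a j" and b_nonneg: "\<And>j. 2 \<le> j \<Longrightarrow> 0 \<le> b j"
    using less_imp_le[OF a] less_imp_le[OF b] by blast+
  note bounds = spatial_partitions_bounds[OF lam]
  have X: "finite X" using spatial_partitions_finite_support[OF lam] by (simp add: X_def)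
  have "Y \<subseteq> (\<lambda>e. case e of Jump x y \<Rightarrow> y | _ \<Rightarrow> undefined) ` F"
    by (force simp: Y_def image_iff)
  then have Y: "finite Y" using F(1) finite_surj by blast
  have I: "finite I" "finite I2" using X by (auto simp: I_def I2_def)
  have I2: "I2 \<subseteq> I" by (auto simp: I_def I2_def)
  have fin: "finite C" "finite D" "finite E" using X Y I by (auto simp: C_def D_def E_def)
  have clusters: "(\<Sum>(x, j)\<in>I. real (count (lam x) j)) \<le> real n"
  proof -
    have "(\<Sum>(x, j)\<in>I. real (count (lam x) j)) = (\<Sum>x\<in>X. \<Sum>j\<in>set_mset (lam x). real (count (lam x) j))"
      unfolding I_def using X by (subst sum.Sigma) auto
    also have "\<dots> = real (\<Sum>x\<in>X. size (lam x))"
      unfolding of_nat_sum size_multiset_overloaded_eq ..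
    also have "\<dots> \<le> real n"
      using bounds(1) unfolding X_def of_nat_le_iff .
    finally show ?thesis .
  qed
  have rate_C: "?r (Coag x j) \<le> real n * (sum a {1..n}) * real (count (lam x) j)" if "(x, j) \<in> I" for x j
  proof -
    from that have j: "1 \<le> j" "j \<le> n" using bounds(3) by (auto simp: I_def)
    have "?r (Coag x j) \<le> a j * (real (count (lam x) j) * real (count (lam x) 1))"
    proof (cases "j = 1")
      case True
      have "a 1 * (real (count (lam x) 1) * (real (count (lam x) 1) - 1))
          \<le> a 1 * (real (count (lam x) 1) * real (count (lam x) 1))"
        using a[of 1] by (intro mult_left_mono) auto
      then show ?thesis using True by (simp add: mult.assoc)
    qed (simp add: mult.assoc)
    also have "\<dots> \<le> (sum a {1..n}) * (real (count (lam x) j) * real n)"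
      using j a_nonneg bounds(2)[of x 1]
      by (intro mult_mono member_le_sum sum_nonneg mult_nonneg_nonneg) auto
    finally show ?thesis by (simp add: mult_ac)
  qed
  have rate_D: "?r (Frag x j) \<le> (sum b {2..n}) * real (count (lam x) j)" if "(x, j) \<in> I2" for x j
  proof -
    from that have j: "2 \<le> j" "j \<le> n" using bounds(3) by (auto simp: I2_def)
    then show ?thesis
      using b_nonneg unfolding event_rate.simps by (intro mult_right_mono member_le_sum) auto
  qed
  have nonneg: "0 \<le> ?r e" if "e \<in> C \<union> D \<union> E" for e
    using that
  proof (elim UnE)
    assume "e \<in> E" then show ?thesis using t by (auto simp: E_def)
  next
    assume "e \<in> C"
    then have "admissible e" using bounds(3) by (auto simp: C_def I_def)
    show ?thesis by (rule event_rate_nonneg) (fact a b t \<open>admissible e\<close>)+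
  next
    assume "e \<in> D"
    then have "admissible e" by (auto simp: D_def I2_def)
    show ?thesis by (rule event_rate_nonneg) (fact a b t \<open>admissible e\<close>)+
  qed
  have covered: "e \<in> C \<union> D \<union> E" if e: "e \<in> F" and "?r e \<noteq> 0" for e
  proof (cases e)
    case (Coag x j)
    with \<open>?r e \<noteq> 0\<close> have "count (lam x) j \<noteq> 0" by (cases "j = 1") simp_all
    then have "j \<in># lam x" by simp
    then have "(x, j) \<in> I" by (auto simp: I_def X_def)
    with Coag show ?thesis by (force simp: C_def)
  next
    case (Frag x j)
    with e F(2) have "2 \<le> j" by auto
    moreover from Frag \<open>?r e \<noteq> 0\<close> have "j \<in># lam x" by (simp flip: count_greater_zero_iff)
    ultimately have "(x, j) \<in> I2" by (auto simp: I2_def X_def)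
    with Frag show ?thesis by (force simp: D_def)
  next
    case (Jump x y)
    have "lam x \<noteq> {#}" using \<open>?r e \<noteq> 0\<close> unfolding Jump by (intro notI) simp
    moreover have "y \<in> Y" using e unfolding Jump Y_def by blast
    ultimately have "(x, y) \<in> X \<times> Y" by (simp add: X_def)
    with Jump show ?thesis by (force simp: E_def)
  qed
  have "sum ?r F = sum ?r (F \<inter> (C \<union> D \<union> E))"
    using F(1) covered by (intro sum.mono_neutral_right) auto
  also have "\<dots> \<le> sum ?r (C \<union> D \<union> E)"
    using fin nonneg by (intro sum_mono2) auto
  also have "\<dots> = sum ?r C + sum ?r D + sum ?r E"
  proof -
    have "sum ?r (C \<union> D \<union> E) = sum ?r (C \<union> D) + sum ?r E"
      using fin by (intro sum.union_disjoint) (auto simp: C_def D_def E_def)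
    also have "sum ?r (C \<union> D) = sum ?r C + sum ?r D"
      using fin by (intro sum.union_disjoint) (auto simp: C_def D_def)
    finally show ?thesis .
  qed
  also have "sum ?r C \<le> real n * (sum a {1..n}) * real n"
  proof -
    have "sum ?r C = (\<Sum>(x, j)\<in>I. ?r (Coag x j))"
      unfolding C_def by (subst sum.reindex) (auto simp: inj_on_def case_prod_unfold simp del: event_rate.simps)
    also have "\<dots> \<le> (\<Sum>(x, j)\<in>I. real n * (sum a {1..n}) * real (count (lam x) j))"
      using rate_C by (intro sum_mono) auto
    also have "\<dots> = real n * (sum a {1..n}) * (\<Sum>(x, j)\<in>I. real (count (lam x) j))"
      by (simp add: sum_distrib_left case_prod_unfold)
    also have "\<dots> \<le> real n * (sum a {1..n}) * real n"
      using a_nonneg by (intro mult_left_mono clusters mult_nonneg_nonneg sum_nonneg) auto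
    finally show ?thesis .
  qed
  also have "sum ?r D \<le> sum b {2..n} * real n"
  proof -
    have "sum ?r D = (\<Sum>(x, j)\<in>I2. ?r (Frag x j))"
      unfolding D_def by (subst sum.reindex) (auto simp: inj_on_def case_prod_unfold simp del: event_rate.simps)
    also have "\<dots> \<le> (\<Sum>(x, j)\<in>I2. sum b {2..n} * real (count (lam x) j))"
      using rate_D by (intro sum_mono) auto
    also have "\<dots> = sum b {2..n} * (\<Sum>(x, j)\<in>I2. real (count (lam x) j))"
      by (simp add: sum_distrib_left case_prod_unfold)
    also have "\<dots> \<le> sum b {2..n} * real n"
    proof (intro mult_left_mono)
      have "(\<Sum>(x, j)\<in>I2. real (count (lam x) j)) \<le> (\<Sum>(x, j)\<in>I. real (count (lam x) j))"
        using I I2 by (intro sum_mono2) auto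
      with clusters show "(\<Sum>(x, j)\<in>I2. real (count (lam x) j)) \<le> real n" by simp
      show "0 \<le> sum b {2..n}" using b_nonneg by (intro sum_nonneg) auto
    qed
    finally show ?thesis .
  qed
  also have "sum ?r E \<le> real n"
  proof -
    have "sum ?r E = (\<Sum>(x, y)\<in>X \<times> Y. real (count (lam x) 1) * t x y)"
      unfolding E_def by (subst sum.reindex) (auto simp: inj_on_def case_prod_unfold)
    also have "\<dots> = (\<Sum>x\<in>X. real (count (lam x) 1) * (\<Sum>y\<in>Y. t x y))"
      by (simp add: sum.cartesian_product[symmetric] sum_distrib_left)
    also have "\<dots> \<le> (\<Sum>x\<in>X. real (size (lam x)) * 1)"
    proof (intro sum_mono mult_mono)
      fix x
      show "(\<Sum>y\<in>Y. t x y) \<le> 1"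
        using finite_sum_le_has_sum[OF t_sum[of x] Y] t by auto
    qed (use t in \<open>auto intro: sum_nonneg simp: count_le_size\<close>)
    also have "\<dots> \<le> real n"
      using bounds(1) unfolding X_def mult_1_right of_nat_sum[symmetric] of_nat_le_iff .
    finally show ?thesis .
  qed
  finally show ?thesis by (simp add: exit_rate_bound_def)
qed

text \<open>An event determines the configuration it leads to, so the sets of events leading to different configurations are
  disjoint, and the exit rate is at most the total rate of all events.\<close>

lemma bounded_rates_transition_rate:
  fixes t :: "int ^ ('d::finite) \<Rightarrow> int ^ 'd \<Rightarrow> real"
  assumes a: "\<And>j. 1 \<le> j \<Longrightarrow> 0 < a j" and b: "\<And>j. 2 \<le> j \<Longrightarrow> 0 < b j"
    and t: "\<And>x y. 0 \<le> t x y" and t_sum: "\<And>x. (t x has_sum 1) UNIV"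
  shows "bounded_rates (spatial_partitions n) (transition_rate a b t) (exit_rate_bound a b n)"
proof
  have rates: "event_rate a b t e lam \<ge> 0" if "admissible e" for e lam
    by (rule event_rate_nonneg) (fact a b t that)+
  show "0 \<le> transition_rate a b t lam mu" for lam mu
    unfolding transition_rate_def by (rule infsum_nonneg) (simp only: mem_Collect_eq rates)
  show "0 < exit_rate_bound a b n"
    unfolding exit_rate_bound_def using less_imp_le[OF a] less_imp_le[OF b]
    by (intro add_nonneg_pos add_nonneg_nonneg mult_nonneg_nonneg sum_nonneg) auto
  fix lam assume lam: "lam \<in> (spatial_partitions n :: 'd config set)"
  let ?r = "\<lambda>e. event_rate a b t e lam"
  let ?E = "\<lambda>mu. {e. admissible e \<and> target e lam = mu}"
  let ?\<Sigma> = "Sigma (spatial_partitions n - {lam}) ?E"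
  have sum_le: "sum ?r F \<le> exit_rate_bound a b n" if "finite F" "F \<subseteq> {e. admissible e}" for F
    by (rule sum_event_rate_le) (fact a b t t_sum lam that)+
  have summable: "?r summable_on {e. admissible e}"
  proof (rule nonneg_bdd_above_summable_on)
    show "bdd_above (sum ?r ` {F. F \<subseteq> {e. admissible e} \<and> finite F})"
      by (rule bdd_aboveI2[where M = "exit_rate_bound a b n"]) (rule sum_le; simp)
  qed (simp only: mem_Collect_eq rates)
  have inj: "inj_on snd ?\<Sigma>" by (auto simp: inj_on_def)
  have sub: "snd ` ?\<Sigma> \<subseteq> {e. admissible e}" by auto
  have "?r summable_on snd ` ?\<Sigma>"
    by (rule summable_on_subset_banach[OF summable sub])
  then have Sigma: "(?r \<circ> snd) summable_on ?\<Sigma>"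
    using summable_on_reindex[OF inj] by blast
  have T: "transition_rate a b t lam = (\<lambda>mu. \<Sum>\<^sub>\<infinity>e\<in>?E mu. (?r \<circ> snd) (mu, e))"
    by (simp add: transition_rate_def fun_eq_iff)
  show "transition_rate a b t lam summable_on spatial_partitions n - {lam}"
    unfolding T by (rule summable_on_Sigma_banach) (use Sigma in \<open>simp add: case_prod_unfold comp_def\<close>)
  have "infsum (transition_rate a b t lam) (spatial_partitions n - {lam}) = infsum (?r \<circ> snd) ?\<Sigma>"
    unfolding T by (rule infsum_Sigma_banach[OF Sigma])
  also have "\<dots> = infsum ?r (snd ` ?\<Sigma>)"
    by (rule infsum_reindex[OF inj, symmetric])
  also have "\<dots> \<le> exit_rate_bound a b n"
    by (rule infsum_le_finite_sums[OF \<open>?r summable_on snd ` ?\<Sigma>\<close>])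
       (use sub in \<open>blast intro: sum_le\<close>)
  finally show "infsum (transition_rate a b t lam) (spatial_partitions n - {lam}) \<le> exit_rate_bound a b n" .
qed

theorem proposition4p5:
  fixes V :: "real ^ ('d::finite) \<Rightarrow> ereal"
    and L z :: real and n :: nat
    and \<theta> a b :: "nat \<Rightarrow> real"
    and t :: "int ^ 'd \<Rightarrow> int ^ 'd \<Rightarrow> real"
  assumes L: "0 < L"
    and V: "\<And>u. V u \<noteq> -\<infinity>"
    and theta: "\<And>j. 1 \<le> j \<Longrightarrow> 0 \<le> \<theta> j"
    and Z_finite: "gibbs_weight V L \<theta> summable_on spatial_partitions n"
    and Z_nonzero: "partition_function V L \<theta> n \<noteq> 0"
    and a_pos: "\<And>j. 1 \<le> j \<Longrightarrow> 0 < a j"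
    and b_pos: "\<And>j. 2 \<le> j \<Longrightarrow> 0 < b j"
    and balance: "\<And>j. 1 \<le> j \<Longrightarrow>
        a j * (\<theta> j / real j) * \<theta> 1 = b (j + 1) * (\<theta> (j + 1) / real (j + 1))"
    and t_nonneg: "\<And>x y. 0 \<le> t x y"
    and t_sum: "\<And>x. (t x has_sum 1) UNIV"
    and t_balance: "\<And>x y. boltzmann V L 1 x * t x y = boltzmann V L 1 y * t y x"
    and z: "0 < z"
    and z_summable: "\<And>L'. 0 < L' \<Longrightarrow>
        (\<lambda>(x, j). \<theta> j / real j * z ^ j * boltzmann V L' j x) summable_on (UNIV \<times> {1..})"
    and jump_summable: "(\<lambda>(x, y). boltzmann V L 1 x * t x y) summable_on UNIV"
    and frag_summable:
      "(\<lambda>(x, j). b j * (\<theta> j / real j) * z ^ j * boltzmann V L j x) summable_on (UNIV \<times> {2..})"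
  shows "\<exists>P :: real \<Rightarrow> 'd config \<Rightarrow> 'd config pmf.
      markov_semigroup (spatial_partitions n) P \<and>
      has_rates (spatial_partitions n) (transition_rate a b t) P \<and>
      (\<forall>P'. markov_semigroup (spatial_partitions n) P' \<and>
            has_rates (spatial_partitions n) (transition_rate a b t) P' \<longrightarrow>
            (\<forall>s\<ge>0. \<forall>lam\<in>spatial_partitions n. P' s lam = P s lam)) \<and>
      reversible_measure (spatial_partitions n) P (gibbs_prob V L \<theta> n) \<and>
      stationary_measure (spatial_partitions n) P (gibbs_prob V L \<theta> n) \<and>
      (\<forall>(M :: 'w measure) X.
         markov_process (spatial_partitions n) P (gibbs_prob V L \<theta> n) M X \<longrightarrow>
         reversible_process (spatial_partitions n) M X \<and>
         stationary_process (spatial_partitions n) M X)"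
proof -
  interpret bounded_rates "spatial_partitions n :: 'd config set" "transition_rate a b t" "exit_rate_bound a b n"
    by (rule bounded_rates_transition_rate[OF a_pos b_pos t_nonneg t_sum])
  let ?S = "spatial_partitions n :: 'd config set" and ?p = "gibbs_prob V L \<theta> n"
  have rev: "reversible_measure ?S uniformized ?p"
  proof (rule uniformized_reversible)
    fix lam mu assume "lam \<in> ?S" "mu \<in> ?S"
    then have "finite {x. lam x \<noteq> {#}}" "finite {x. mu x \<noteq> {#}}"
      by (simp_all add: spatial_partitions_finite_support)
    then show "?p lam * transition_rate a b t lam mu = ?p mu * transition_rate a b t mu lam"
      using transition_rate_balance[OF V balance t_balance] by (simp add: gibbs_prob_def)
  qed
  have stat: "stationary_measure ?S uniformized ?p"
    by (rule stationary_of_reversible[OF markov_semigroup_uniformized rev])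
  have "reversible_process ?S M X \<and> stationary_process ?S M X"
    if "markov_process ?S uniformized ?p M X" for M :: "'w measure" and X
  proof -
    interpret reversible_markov_process ?S uniformized ?p M X
      by unfold_locales (fact countable_spatial_partitions rev stat that)+
    show ?thesis using reversible_process stationary_process by blast
  qed
  then show ?thesis
    by (intro exI[of _ uniformized] conjI allI impI ballI markov_semigroup_uniformized
        has_rates_uniformized rev stat uniformized_unique; simp)
qed

end
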